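(* Let $T>0$ and let the following assumptions hold. (Operator) $\mathcal L$ is an unbounded closed operator on $L^2(\mathbb R^d)$ with dense domain $D\subseteq L^2(\mathbb R^d)$ generating a $C_0$-semigroup $(T_t)_{t\ge 0}$ on $L^2(\mathbb R^d)$, with $M>0$, $w\in\mathbb R$ such that $\|T_t\|\le Me^{wt}$ for $t\ge 0$. (Bounded potential) $Q=\sum_{\gamma\in\mathcal I}q_\gamma H_\gamma\in L^\infty(\mathbb R^d)\hat\otimes_\pi (S)_{-1}$ with $\sup_{\gamma\in\mathcal I}\|q_\gamma\|_{L^\infty}\in(0,\infty)$. (Force) $F\in AC([0,T];L^2(\mathbb R^d))\hat\otimes_\pi (S)_{-1}$. (Initial condition) $G\in D\hat\otimes_\pi (S)_{-1}$. Consider the problem $$\Big(\frac{\partial}{\partial t}-\mathcal L\Big)U(t,x,\omega)+Q(x,\omega)\,\lozenge\,U(t,x,\omega)=F(t,x,\omega),\qquad U(0,x,\omega)=G(x,\omega).\qquad(\ast)$$ Let $V\in AC([0,T];L^2(\mathbb R^d))\hat\otimes_\pi (S)_{-1}$ be the (unique) stochastic weak solution of $(\ast)$, and let $(U_\varepsilon)_{\varepsilon\in(0,1]}\subset AC([0,T];L^2(\mathbb R^d))\hat\otimes_\pi (S)_{-1}$ be the stochastic very weak solution of $(\ast)$ obtained by regularization, i.e. the moderate net for which, for each $\varepsilon\in(0,1]$, $U_\varepsilon$ is the stochastic weak solution of $(\ast)$ with $Q$ replaced by $Q_\varepsilon=Q*_x\varphi_\varepsilon$. Then for some $p>1$ $$|||U_\varepsilon-V|||_{-p}\to0\qquad\text{as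 }\varepsilon\to0 .$$
   Context: Multi-indices: $\mathbb N=\{1,2,\dots\}$, $\mathbb N_0=\mathbb N\cup\{0\}$. $\mathcal I$ is the set of sequences $\gamma=(\gamma_1,\gamma_2,\dots)$ of non-negative integers with finitely many nonzero entries; $\mathbf 0$ is the zero sequence; $|\gamma|=\sum_i\gamma_i$. $(2\mathbb N)^{r\gamma}:=\prod_k(2k)^{r\gamma_k}$ for real $r$. Probability space: $\Omega=\mathcal S'(\mathbb R^d)$ with the Gaussian white noise measure $\mu$. $H_\gamma(\omega)=\prod_{k}h_{\gamma_k}(\langle\omega,\eta_k\rangle)$, $\gamma\in\mathcal I$, are the Fourier–Hermite polynomials ($h_n$ Hermite polynomials, $(\eta_k)_k$ the orthonormal basis of $L^2(\mathbb R^d)$ given by tensor products of Hermite functions in a fixed ordering); they form an orthogonal basis of $L^2(\mu)$ with $\|H_\gamma\|^2_{L^2(\mu)}=\gamma!$. Generalized stochastic processes (GSPs) of Kondratiev type: for a normed space $X$ and $p\in\mathbb N$, $X\hat\otimes_\pi(S)_{-1,-p}$ is the space of formal series $F=\sum_{\gamma\in\mathcal I}f_\gamma H_\gamma$, $f_\gamma\in X$, with $|||F|||_{-p}^2:=\sum_{\gamma}\|f_\gamma\|_X^2(2\mathbb N)^{-p\gamma}<\infty$; $X\hat\otimes_\pi(S)_{-1}$ is the inductive limit (union) over $p\in\mathbb N$. For $U_\varepsilon-V$, $|||\cdot|||_{-p}$ is taken with $X=AC([0,T];L^2(\mathbb R^d))$. $AC([0,T];L^2(\mathbb R^d))$ is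 the space of absolutely continuous $L^2(\mathbb R^d)$-valued functions on $[0,T]$ (differentiable a.e. with integrable derivative); the norm used on it in the Kondratiev norms is $\sup_{t\in[0,T]}\|f(t,\cdot)\|_{L^2}$. $D$ carries the $L^2$ norm. Wick product: $\big(\sum_\alpha u_\alpha H_\alpha\big)\lozenge\big(\sum_\beta v_\beta H_\beta\big):=\sum_{\gamma}\big(\sum_{\alpha+\beta=\gamma}u_\alpha v_\beta\big)H_\gamma$. $\mathcal L$ acts coefficientwise. Stochastic weak solution (for a potential $R=\sum_\gamma r_\gamma H_\gamma\in L^\infty(\mathbb R^d)\hat\otimes_\pi(S)_{-1}$, with $F=\sum f_\gamma H_\gamma$, $G=\sum g_\gamma H_\gamma$): $U=\sum_\gamma u_\gamma H_\gamma\in AC([0,T];D)\hat\otimes_\pi(S)_{-1}$ such that for every $\gamma$ the coefficient $u_\gamma\in AC([0,T];D)$ is a weak solution of $(\partial_t-\mathcal L)u_\gamma+r_{\mathbf 0}u_\gamma=\tilde f_\gamma$, $u_\gamma(0,\cdot)=g_\gamma$, with $\tilde f_{\mathbf 0}=f_{\mathbf 0}$ and $\tilde f_\gamma=f_\gamma-\sum_{\alpha+\beta=\gamma,\ \alpha\neq\mathbf 0}r_\alpha u_\beta$ for $|\gamma|\ge1$. Weak solutions of these deterministic problems are understood in the sense of semigroup theory, i.e. $u_\gamma(t)=T_tg_\gamma+\int_0^tT_{t-s}(\tilde f_\gamma(s)-r_{\mathbf 0}u_\gamma(s))ds$. Regularizing net: a mollifier is $\varphi\in C_0^\infty(\mathbb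 R^d)$, $\varphi\ge0$, $\int\varphi=1$; a mollifying net is $\varphi_\varepsilon(x)=\lambda_\varepsilon^{-d}\varphi(x/\lambda_\varepsilon)$, $\varepsilon\in(0,1]$, where $\lambda_\varepsilon>0$, $\lambda_\varepsilon\to0$ as $\varepsilon\to0$ (basic case $\lambda_\varepsilon=\varepsilon$; logarithmic scales are allowed). The associated regularizing net of $Q$ is $Q_\varepsilon:=Q*_x\varphi_\varepsilon=\sum_\gamma(q_\gamma*\varphi_\varepsilon)H_\gamma$. Moderateness of $(U_\varepsilon)_\varepsilon\subset X\hat\otimes_\pi(S)_{-1}$: there exist $N\in\mathbb N_0$ and $C>0$, independent of $\varepsilon$, such that for each $\varepsilon\in(0,1]$ there is $p_\varepsilon\in\mathbb N$ with $|||U_\varepsilon|||_{-p}\le C\varepsilon^{-N}$ for all $p\ge p_\varepsilon$. In the claim, $X=AC([0,T];L^2(\mathbb R^d))$. *)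

theory Defs
  imports "HOL-Probability.Probability" "HOL-Library.Poly_Mapping"
begin

section \<open>The space L2 of Euclidean space\<close>

definition square_integrable :: "('a::euclidean_space \<Rightarrow> 'b::{banach,second_countable_topology}) \<Rightarrow> bool" where
  "square_integrable f \<longleftrightarrow>
     f \<in> borel_measurable lborel \<and> integrable lborel (\<lambda>x. (norm (f x))\<^sup>2)"

definition L2_rel ::
  "('a::euclidean_space \<Rightarrow> 'b::{banach,second_countable_topology}) \<Rightarrow> ('a \<Rightarrow> 'b) \<Rightarrow> bool" where
  "L2_rel f g \<longleftrightarrow> square_integrable f \<and> square_integrable g \<and> (AE x in lborel. f x = g x)"

lemma square_integrable_zero: "square_integrable (\<lambda>x. 0)"
  by (simp add: square_integrable_def)

lemma square_integrable_scaleR: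
  "square_integrable f \<Longrightarrow> square_integrable (\<lambda>x. c *\<^sub>R f x)"
  by (auto simp: square_integrable_def power_mult_distrib)

lemma square_integrable_add:
  assumes "square_integrable f" "square_integrable g"
  shows "square_integrable (\<lambda>x. f x + g x)"
proof -
  have [measurable]: "f \<in> borel_measurable lborel" "g \<in> borel_measurable lborel"
    using assms by (auto simp: square_integrable_def)
  have "integrable lborel (\<lambda>x. 2 * (norm (f x))\<^sup>2 + 2 * (norm (g x))\<^sup>2)"
    using assms by (auto simp: square_integrable_def)
  then have "integrable lborel (\<lambda>x. (norm (f x + g x))\<^sup>2)"
  proof (rule Bochner_Integration.integrable_bound)
    show "AE x in lborel. norm ((norm (f x + g x))\<^sup>2)
            \<le> norm (2 * (norm (f x))\<^sup>2 + 2 * (norm (g x))\<^sup>2)"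
    proof (rule AE_I2)
      fix x
      have "(norm (f x + g x))\<^sup>2 \<le> (norm (f x) + norm (g x))\<^sup>2"
        by (simp add: norm_triangle_ineq power_mono)
      also have "\<dots> \<le> 2 * (norm (f x))\<^sup>2 + 2 * (norm (g x))\<^sup>2"
        using sum_squares_bound[of "norm (f x)" "norm (g x)"] by (simp add: power2_sum)
      finally show "norm ((norm (f x + g x))\<^sup>2)
            \<le> norm (2 * (norm (f x))\<^sup>2 + 2 * (norm (g x))\<^sup>2)" by simp
    qed
  qed measurable
  then show ?thesis by (simp add: square_integrable_def)
qed

lemma square_integrable_uminus: "square_integrable f \<Longrightarrow> square_integrable (\<lambda>x. - f x)"
  by (auto simp: square_integrable_def)

lemma square_integrable_diff:
  "square_integrable f \<Longrightarrow> square_integrable g \<Longrightarrow> square_integrable (\<lambda>x. f x - g x)"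
  using square_integrable_add[of f "\<lambda>x. - g x"] square_integrable_uminus[of g] by simp

text \<open>Elements of \<open>('a, 'b) L2\<close> are classes of square integrable functions modulo equality
  almost everywhere. Where multiplication is needed, the scalars \<open>'b\<close> form a complete real normed field, which
  covers both the real and the complex space (the latter regarded as a real vector space).\<close>

quotient_type (overloaded) ('a, 'b) L2 =
  "'a::euclidean_space \<Rightarrow> 'b::{banach,second_countable_topology}" / partial: L2_rel
proof (rule part_equivpI)
  show "\<exists>f. L2_rel f f"
    by (rule exI[of _ "\<lambda>x. 0"]) (simp add: L2_rel_def square_integrable_zero)
  show "symp L2_rel"
    by (rule sympI) (auto simp: L2_rel_def)
  show "transp L2_rel"
    by (rule transpI) (auto simp: L2_rel_def)
qed

instantiation L2 :: (euclidean_space, "{banach,second_countable_topology}") real_normed_vector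
begin

lift_definition zero_L2 :: "('a, 'b) L2" is "\<lambda>x. 0"
  by (simp add: L2_rel_def square_integrable_zero)

lift_definition plus_L2 :: "('a, 'b) L2 \<Rightarrow> ('a, 'b) L2 \<Rightarrow> ('a, 'b) L2" is "\<lambda>f g x. f x + g x"
  by (auto simp: L2_rel_def square_integrable_add)

lift_definition minus_L2 :: "('a, 'b) L2 \<Rightarrow> ('a, 'b) L2 \<Rightarrow> ('a, 'b) L2" is "\<lambda>f g x. f x - g x"
  by (auto simp: L2_rel_def square_integrable_diff)

lift_definition uminus_L2 :: "('a, 'b) L2 \<Rightarrow> ('a, 'b) L2" is "\<lambda>f x. - f x"
  by (auto simp: L2_rel_def square_integrable_uminus)

lift_definition scaleR_L2 :: "real \<Rightarrow> ('a, 'b) L2 \<Rightarrow> ('a, 'b) L2" is "\<lambda>c f x. c *\<^sub>R f x"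
  by (auto simp: L2_rel_def square_integrable_scaleR)

lift_definition norm_L2 :: "('a, 'b) L2 \<Rightarrow> real" is
  "\<lambda>f. sqrt (LINT x|lborel. (norm (f x))\<^sup>2)"
  unfolding L2_rel_def square_integrable_def
  by (intro arg_cong[where f = sqrt] Bochner_Integration.integral_cong_AE) auto

definition dist_L2 :: "('a, 'b) L2 \<Rightarrow> ('a, 'b) L2 \<Rightarrow> real" where
  "dist_L2 u v = norm (u - v)"

definition sgn_L2 :: "('a, 'b) L2 \<Rightarrow> ('a, 'b) L2" where
  "sgn_L2 u = inverse (norm u) *\<^sub>R u"

definition uniformity_L2 :: "(('a, 'b) L2 \<times> ('a, 'b) L2) filter" where
  "uniformity_L2 = (INF e\<in>{0<..}. principal {(u, v). dist u v < e})"

definition open_L2 :: "('a, 'b) L2 set \<Rightarrow> bool" where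
  "open_L2 U \<longleftrightarrow> (\<forall>u\<in>U. \<forall>\<^sub>F (u', v) in uniformity. u' = u \<longrightarrow> v \<in> U)"

instance
proof
  fix u v w :: "('a, 'b) L2" and a b :: real
  show "u + v + w = u + (v + w)"
    by transfer (auto simp: L2_rel_def square_integrable_add add.assoc)
  show "u + v = v + u"
    by transfer (auto simp: L2_rel_def square_integrable_add add.commute)
  show "0 + u = u"
    by transfer (auto simp: L2_rel_def)
  show "- u + u = 0"
    by transfer (auto simp: L2_rel_def square_integrable_zero)
  show "u - v = u + - v"
    by transfer (auto simp: L2_rel_def square_integrable_diff)
  show "a *\<^sub>R (u + v) = a *\<^sub>R u + a *\<^sub>R v"
    by transfer (auto simp: L2_rel_def square_integrable_add square_integrable_scaleR scaleR_add_right)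
  show "(a + b) *\<^sub>R u = a *\<^sub>R u + b *\<^sub>R u"
    by transfer (auto simp: L2_rel_def square_integrable_add square_integrable_scaleR scaleR_add_left)
  show "a *\<^sub>R b *\<^sub>R u = (a * b) *\<^sub>R u"
    by transfer (auto simp: L2_rel_def square_integrable_scaleR)
  show "1 *\<^sub>R u = u"
    by transfer (auto simp: L2_rel_def)
  show "dist u v = norm (u - v)"
    by (simp add: dist_L2_def)
  show "sgn u = inverse (norm u) *\<^sub>R u"
    by (simp add: sgn_L2_def)
  show "(uniformity :: (('a, 'b) L2 \<times> ('a, 'b) L2) filter) =
      (INF e\<in>{0<..}. principal {(u, v). dist u v < e})"
    by (simp add: uniformity_L2_def)
  show "open U \<longleftrightarrow> (\<forall>u\<in>U. \<forall>\<^sub>F (u', v) in uniformity. u' = u \<longrightarrow> v \<in> U)" for U :: "('a, 'b) L2 set"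
    by (simp add: open_L2_def)
  show "norm u = 0 \<longleftrightarrow> u = 0"
  proof (transfer, goal_cases)
    case (1 u)
    then have "integrable lborel (\<lambda>x. (norm (u x))\<^sup>2)" and "square_integrable u"
      by (auto simp: L2_rel_def square_integrable_def)
    then show ?case
      by (simp add: L2_rel_def square_integrable_zero integral_nonneg_eq_0_iff_AE)
  qed
  show "norm (a *\<^sub>R u) = \<bar>a\<bar> * norm u"
    by transfer (simp add: power_mult_distrib real_sqrt_mult)
  show "norm (u + v) \<le> norm u + norm v"
  proof (transfer, goal_cases)
    case (1 u v)
    let ?I = "\<lambda>f. LINT x|lborel. f x"
    let ?a = "\<lambda>x. norm (u x)" and ?b = "\<lambda>x. norm (v x)"
    have u: "square_integrable u" and v: "square_integrable v"
      using 1 by (auto simp: L2_rel_def)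
    have [measurable]: "u \<in> borel_measurable lborel" "v \<in> borel_measurable lborel"
      using u v by (auto simp: square_integrable_def)
    have iu: "integrable lborel (\<lambda>x. (?a x)\<^sup>2)" and iv: "integrable lborel (\<lambda>x. (?b x)\<^sup>2)"
      using u v by (auto simp: square_integrable_def)
    have iuv: "integrable lborel (\<lambda>x. ?a x * ?b x)"
    proof (rule Bochner_Integration.integrable_bound)
      show "integrable lborel (\<lambda>x. (?a x)\<^sup>2 + (?b x)\<^sup>2)" using iu iv by simp
      show "AE x in lborel. norm (?a x * ?b x) \<le> norm ((?a x)\<^sup>2 + (?b x)\<^sup>2)"
      proof (rule AE_I2)
        fix x
        show "norm (?a x * ?b x) \<le> norm ((?a x)\<^sup>2 + (?b x)\<^sup>2)"
        proof -
          have "0 \<le> ?a x * ?b x" by simp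
          then have "?a x * ?b x \<le> (?a x)\<^sup>2 + (?b x)\<^sup>2"
            using sum_squares_bound[of "?a x" "?b x"] by linarith
          then show ?thesis by simp
        qed
      qed
    qed measurable
    have nn: "0 \<le> ?I (\<lambda>x. (?a x)\<^sup>2)" "0 \<le> ?I (\<lambda>x. (?b x)\<^sup>2)" "0 \<le> ?I (\<lambda>x. ?a x * ?b x)"
      by auto
    have "ennreal ((?I (\<lambda>x. ?a x * ?b x))\<^sup>2) = (\<integral>\<^sup>+x. ennreal (?a x) * ennreal (?b x) \<partial>lborel)\<^sup>2"
      using nn iuv by (simp add: ennreal_power nn_integral_eq_integral flip: ennreal_mult)
    also have "\<dots> \<le> (\<integral>\<^sup>+x. (ennreal (?a x))\<^sup>2 \<partial>lborel) * (\<integral>\<^sup>+x. (ennreal (?b x))\<^sup>2 \<partial>lborel)"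
      by (rule Cauchy_Schwarz_nn_integral) auto
    also have "\<dots> = ennreal (?I (\<lambda>x. (?a x)\<^sup>2) * ?I (\<lambda>x. (?b x)\<^sup>2))"
      using nn iu iv by (simp add: ennreal_power nn_integral_eq_integral ennreal_mult)
    finally have "(?I (\<lambda>x. ?a x * ?b x))\<^sup>2 \<le> ?I (\<lambda>x. (?a x)\<^sup>2) * ?I (\<lambda>x. (?b x)\<^sup>2)"
      using nn by simp
    then have cs: "?I (\<lambda>x. ?a x * ?b x) \<le> sqrt (?I (\<lambda>x. (?a x)\<^sup>2)) * sqrt (?I (\<lambda>x. (?b x)\<^sup>2))"
      by (metis real_le_rsqrt real_sqrt_mult)
    have "?I (\<lambda>x. (norm (u x + v x))\<^sup>2) \<le> ?I (\<lambda>x. (?a x)\<^sup>2 + (?b x)\<^sup>2 + 2 * (?a x * ?b x))"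
    proof (rule integral_mono)
      show "integrable lborel (\<lambda>x. (norm (u x + v x))\<^sup>2)"
        using square_integrable_add[OF u v] by (simp add: square_integrable_def)
      show "integrable lborel (\<lambda>x. (?a x)\<^sup>2 + (?b x)\<^sup>2 + 2 * (?a x * ?b x))"
        using iu iv iuv by simp
      fix x
      have "(norm (u x + v x))\<^sup>2 \<le> (?a x + ?b x)\<^sup>2"
        by (simp add: norm_triangle_ineq power_mono)
      then show "(norm (u x + v x))\<^sup>2 \<le> (?a x)\<^sup>2 + (?b x)\<^sup>2 + 2 * (?a x * ?b x)"
        by (simp add: power2_sum algebra_simps)
    qed
    also have "\<dots> = ?I (\<lambda>x. (?a x)\<^sup>2) + ?I (\<lambda>x. (?b x)\<^sup>2) + 2 * ?I (\<lambda>x. ?a x * ?b x)"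
      using iu iv iuv by simp
    also have "\<dots> \<le> (sqrt (?I (\<lambda>x. (?a x)\<^sup>2)) + sqrt (?I (\<lambda>x. (?b x)\<^sup>2)))\<^sup>2"
      using cs nn by (simp add: power2_sum)
    finally show ?case
      by (rule real_le_lsqrt[rotated]) (use nn in auto)
  qed
qed

end

section \<open>Essentially bounded functions\<close>

text \<open>Essentially bounded functions are handled through Borel measurable representatives; everything
  below depends on them only up to equality almost everywhere.\<close>

definition Linf :: "('a::euclidean_space \<Rightarrow> 'b::{banach,second_countable_topology}) set" where
  "Linf = {r \<in> borel_measurable lborel. esssup lborel (\<lambda>x. ereal (norm (r x))) < \<infinity>}"

definition Linf_norm :: "('a::euclidean_space \<Rightarrow> 'b::{banach,second_countable_topology}) \<Rightarrow> real" where
  "Linf_norm r = real_of_ereal (esssup lborel (\<lambda>x. ereal (norm (r x))))"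

lemma square_integrable_Linf_mult:
  fixes r f :: "'a::euclidean_space \<Rightarrow> 'b::{real_normed_field,banach,second_countable_topology}"
  assumes r: "r \<in> Linf" and f: "square_integrable f"
  shows "square_integrable (\<lambda>x. r x * f x)"
proof -
  let ?e = "esssup lborel (\<lambda>x. ereal (norm (r x)))"
  have [measurable]: "r \<in> borel_measurable lborel" "f \<in> borel_measurable lborel"
    using r f by (auto simp: Linf_def square_integrable_def)
  obtain C where C: "?e \<le> ereal C"
    using r by (cases ?e) (auto simp: Linf_def)
  have AE: "AE x in lborel. ereal (norm (r x)) \<le> ?e"
    by (rule esssup_AE)
  have "integrable lborel (\<lambda>x. C\<^sup>2 * (norm (f x))\<^sup>2)"
    using f by (auto simp: square_integrable_def)
  then have "integrable lborel (\<lambda>x. (norm (r x * f x))\<^sup>2)"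
  proof (rule Bochner_Integration.integrable_bound)
    show "AE x in lborel. norm ((norm (r x * f x))\<^sup>2) \<le> norm (C\<^sup>2 * (norm (f x))\<^sup>2)"
      using AE
    proof eventually_elim
      case (elim x)
      then have "norm (r x) \<le> C"
        using C order_trans[of "ereal (norm (r x))" ?e "ereal C"] by simp
      then show ?case
        by (simp add: norm_mult power_mult_distrib mult_right_mono power_mono)
    qed
  qed measurable
  then show ?thesis by (simp add: square_integrable_def)
qed

text \<open>Multiplication of a square integrable class by an essentially bounded function (and zero,
  by convention, if the first argument is not essentially bounded).\<close>

lift_definition Linf_mult ::
  "('a::euclidean_space \<Rightarrow> 'b::{real_normed_field,banach,second_countable_topology})
     \<Rightarrow> ('a, 'b) L2 \<Rightarrow> ('a, 'b) L2" is
  "\<lambda>r f. if r \<in> Linf then (\<lambda>x. r x * f x) else (\<lambda>x. 0)"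
  by (auto simp: L2_rel_def square_integrable_Linf_mult square_integrable_zero)

section \<open>Semigroups and their generators\<close>

definition C0_semigroup :: "(real \<Rightarrow> 'x::real_normed_vector \<Rightarrow>\<^sub>L 'x) \<Rightarrow> bool" where
  "C0_semigroup S \<longleftrightarrow>
     S 0 = id_blinfun \<and>
     (\<forall>s\<ge>0. \<forall>t\<ge>0. S (s + t) = S s o\<^sub>L S t) \<and>
     (\<forall>x. ((\<lambda>t. S t x) \<longlongrightarrow> x) (at_right 0))"

text \<open>An operator is given by its domain \<open>D\<close> and a function \<open>L\<close> that is only relevant on \<open>D\<close>.\<close>

definition is_generator ::
  "'x::real_normed_vector set \<Rightarrow> ('x \<Rightarrow> 'x) \<Rightarrow> (real \<Rightarrow> 'x \<Rightarrow>\<^sub>L 'x) \<Rightarrow> bool" where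
  "is_generator D L S \<longleftrightarrow>
     D = {x. \<exists>y. ((\<lambda>h. (S h x - x) /\<^sub>R h) \<longlongrightarrow> y) (at_right 0)} \<and>
     (\<forall>x\<in>D. ((\<lambda>h. (S h x - x) /\<^sub>R h) \<longlongrightarrow> L x) (at_right 0))"

definition closed_operator :: "'x::real_normed_vector set \<Rightarrow> ('x \<Rightarrow> 'x) \<Rightarrow> bool" where
  "closed_operator D L \<longleftrightarrow> closed ((\<lambda>x. (x, L x)) ` D)"

section \<open>Absolutely continuous functions\<close>

text \<open>Since L2 is a Hilbert space, absolutely continuous functions with values in it are
  automatically differentiable almost everywhere with integrable derivative. Only the values on
  \<open>{0..T}\<close> matter; \<open>X\<close> is the set (with the ambient norm) in which they have to lie.\<close>

definition AC :: "real \<Rightarrow> 'x::real_normed_vector set \<Rightarrow> (real \<Rightarrow> 'x) set" where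
  "AC T X = {f. f ` {0..T} \<subseteq> X \<and>
     (\<forall>e>0. \<exists>\<delta>>0. \<forall>n. \<forall>a b :: nat \<Rightarrow> real.
        (\<forall>i<n. 0 \<le> a i \<and> a i \<le> b i \<and> b i \<le> T) \<and>
        disjoint_family_on (\<lambda>i. {a i<..<b i}) {..<n} \<and>
        (\<Sum>i<n. b i - a i) < \<delta>
        \<longrightarrow> (\<Sum>i<n. norm (f (b i) - f (a i))) < e)}"

definition sup_norm :: "real \<Rightarrow> (real \<Rightarrow> 'x::real_normed_vector) \<Rightarrow> real" where
  "sup_norm T f = (SUP t\<in>{0..T}. norm (f t))"

section \<open>Generalized stochastic processes\<close>

text \<open>Positions are counted from 0 here: the value of a multi-index at \<open>k\<close> is its entry number
  \<open>k + 1\<close>.\<close>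

type_synonym multiindex = "nat \<Rightarrow>\<^sub>0 nat"

definition two_N_pow :: "real \<Rightarrow> multiindex \<Rightarrow> real" where
  "two_N_pow r \<gamma> =
     (\<Prod>k\<in>Poly_Mapping.keys \<gamma>. (2 * real (k + 1)) powr (r * real (Poly_Mapping.lookup \<gamma> k)))"

text \<open>The formal series with coefficients \<open>F \<gamma>\<close> along the Fourier-Hermite polynomials is
  identified with its coefficient family \<open>F\<close>. The coefficient space is given by a carrier \<open>X\<close> and
  a norm \<open>nrm\<close>.\<close>

type_synonym 'x gsp = "multiindex \<Rightarrow> 'x"

definition kondratiev_norm :: "('x \<Rightarrow> real) \<Rightarrow> nat \<Rightarrow> 'x gsp \<Rightarrow> ennreal" where
  "kondratiev_norm nrm p F =
     (if (\<lambda>\<gamma>. (nrm (F \<gamma>))\<^sup>2 * two_N_pow (- real p) \<gamma>) summable_on UNIV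
      then ennreal (sqrt (\<Sum>\<^sub>\<infinity>\<gamma>. (nrm (F \<gamma>))\<^sup>2 * two_N_pow (- real p) \<gamma>))
      else \<infinity>)"

definition kondratiev :: "'x set \<Rightarrow> ('x \<Rightarrow> real) \<Rightarrow> 'x gsp set" where
  "kondratiev X nrm = {F. (\<forall>\<gamma>. F \<gamma> \<in> X) \<and> (\<exists>p\<ge>1. kondratiev_norm nrm p F < \<infinity>)}"

definition wick :: "('x \<Rightarrow> 'y \<Rightarrow> 'z::comm_monoid_add) \<Rightarrow> 'x gsp \<Rightarrow> 'y gsp \<Rightarrow> 'z gsp" where
  "wick m R U \<gamma> = (\<Sum>(\<alpha>, \<beta>)\<in>{(\<alpha>, \<beta>). \<alpha> + \<beta> = \<gamma>}. m (R \<alpha>) (U \<beta>))"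

definition moderate :: "'x set \<Rightarrow> ('x \<Rightarrow> real) \<Rightarrow> (real \<Rightarrow> 'x gsp) \<Rightarrow> bool" where
  "moderate X nrm U \<longleftrightarrow>
     (\<forall>\<epsilon>\<in>{0<..1}. U \<epsilon> \<in> kondratiev X nrm) \<and>
     (\<exists>N::nat. \<exists>C>0. \<forall>\<epsilon>\<in>{0<..1}. \<exists>p\<^sub>\<epsilon>\<ge>1. \<forall>p\<ge>p\<^sub>\<epsilon>.
        kondratiev_norm nrm p (U \<epsilon>) \<le> ennreal (C * \<epsilon> powr (- real N)))"

section \<open>Mollifiers and regularization\<close>

primrec C_k :: "nat \<Rightarrow> ('a::euclidean_space \<Rightarrow> real) \<Rightarrow> bool" where
  "C_k 0 f \<longleftrightarrow> continuous_on UNIV f"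
| "C_k (Suc k) f \<longleftrightarrow>
     (\<forall>x. f differentiable (at x)) \<and>
     (\<forall>b\<in>Basis. C_k k (\<lambda>x. frechet_derivative f (at x) b))"

definition mollifier :: "('a::euclidean_space \<Rightarrow> real) \<Rightarrow> bool" where
  "mollifier \<phi> \<longleftrightarrow>
     (\<forall>k. C_k k \<phi>) \<and> compact (closure {x. \<phi> x \<noteq> 0}) \<and>
     (\<forall>x. \<phi> x \<ge> 0) \<and> (LINT x|lborel. \<phi> x) = 1"

definition mollifying_net ::
  "('a::euclidean_space \<Rightarrow> real) \<Rightarrow> (real \<Rightarrow> real) \<Rightarrow> real \<Rightarrow> 'a \<Rightarrow> real" where
  "mollifying_net \<phi> \<Lambda> \<epsilon> x = \<phi> (x /\<^sub>R \<Lambda> \<epsilon>) / \<Lambda> \<epsilon> ^ DIM('a)"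

definition convolve ::
  "('a::euclidean_space \<Rightarrow> 'b::{banach,second_countable_topology}) \<Rightarrow> ('a \<Rightarrow> real) \<Rightarrow> 'a \<Rightarrow> 'b" where
  "convolve q \<psi> x = (LINT y|lborel. \<psi> (x - y) *\<^sub>R q y)"

definition regularize ::
  "('a::euclidean_space \<Rightarrow> 'b::{banach,second_countable_topology}) gsp
     \<Rightarrow> ('a \<Rightarrow> real) \<Rightarrow> ('a \<Rightarrow> 'b) gsp" where
  "regularize Q \<psi> \<gamma> = convolve (Q \<gamma>) \<psi>"

section \<open>Stochastic weak and very weak solutions\<close>

text \<open>Weak solution, in the sense of semigroup theory, of
  \<open>(\<partial>\<^sub>t - L) u + r u = f\<close>, \<open>u(0) = g\<close> on \<open>{0..T}\<close>, where \<open>S\<close> is the semigroup generated by \<open>L\<close>.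
  For the functions \<open>u\<close> and \<open>f\<close> in question (absolutely continuous in time) the integrand is
  continuous, so that the gauge integral used here is the Riemann (and the Bochner) integral.\<close>

definition weak_solution ::
  "real \<Rightarrow> (real \<Rightarrow> ('a, 'b) L2 \<Rightarrow>\<^sub>L ('a, 'b) L2) \<Rightarrow>
   ('a::euclidean_space \<Rightarrow> 'b::{real_normed_field,banach,second_countable_topology}) \<Rightarrow>
   (real \<Rightarrow> ('a, 'b) L2) \<Rightarrow> ('a, 'b) L2 \<Rightarrow> (real \<Rightarrow> ('a, 'b) L2) \<Rightarrow> bool" where
  "weak_solution T S r f g u \<longleftrightarrow>
     (\<forall>t\<in>{0..T}.
        ((\<lambda>s. S (t - s) (f s - Linf_mult r (u s))) has_integral (u t - S t g)) {0..t})"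

text \<open>The right hand side of the equation for the coefficient with index \<open>\<gamma>\<close>.\<close>

definition propagator_force ::
  "('a::euclidean_space \<Rightarrow> 'b::{real_normed_field,banach,second_countable_topology}) gsp \<Rightarrow>
   (real \<Rightarrow> ('a, 'b) L2) gsp \<Rightarrow> (real \<Rightarrow> ('a, 'b) L2) gsp \<Rightarrow> (real \<Rightarrow> ('a, 'b) L2) gsp" where
  "propagator_force R F U \<gamma> t =
     (if \<gamma> = 0 then F 0 t
      else F \<gamma> t -
        (\<Sum>(\<alpha>, \<beta>)\<in>{(\<alpha>, \<beta>). \<alpha> + \<beta> = \<gamma> \<and> \<alpha> \<noteq> 0}. Linf_mult (R \<alpha>) (U \<beta> t)))"

definition stochastic_weak_solution ::
  "real \<Rightarrow> (real \<Rightarrow> ('a, 'b) L2 \<Rightarrow>\<^sub>L ('a, 'b) L2) \<Rightarrow> ('a, 'b) L2 set \<Rightarrow>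
   ('a::euclidean_space \<Rightarrow> 'b::{real_normed_field,banach,second_countable_topology}) gsp \<Rightarrow>
   (real \<Rightarrow> ('a, 'b) L2) gsp \<Rightarrow> ('a, 'b) L2 gsp \<Rightarrow> (real \<Rightarrow> ('a, 'b) L2) gsp \<Rightarrow> bool" where
  "stochastic_weak_solution T S D R F G U \<longleftrightarrow>
     U \<in> kondratiev (AC T D) (sup_norm T) \<and>
     (\<forall>\<gamma>. weak_solution T S (R 0) (propagator_force R F U \<gamma>) (G \<gamma>) (U \<gamma>))"

definition stochastic_very_weak_solution ::
  "real \<Rightarrow> (real \<Rightarrow> ('a, 'b) L2 \<Rightarrow>\<^sub>L ('a, 'b) L2) \<Rightarrow> ('a, 'b) L2 set \<Rightarrow>
   (real \<Rightarrow> ('a::euclidean_space \<Rightarrow> 'b::{real_normed_field,banach,second_countable_topology}) gsp) \<Rightarrow>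
   (real \<Rightarrow> ('a, 'b) L2) gsp \<Rightarrow> ('a, 'b) L2 gsp \<Rightarrow> (real \<Rightarrow> (real \<Rightarrow> ('a, 'b) L2) gsp) \<Rightarrow> bool" where
  "stochastic_very_weak_solution T S D Rnet F G Unet \<longleftrightarrow>
     moderate (AC T UNIV) (sup_norm T) Unet \<and>
     (\<forall>\<epsilon>\<in>{0<..1}. stochastic_weak_solution T S D (Rnet \<epsilon>) F G (Unet \<epsilon>))"

lemma finite_multiindex_decompositions: "finite {(\<alpha>::multiindex, \<beta>). \<alpha> + \<beta> = \<gamma>}"
proof -
  let ?lk = "Poly_Mapping.lookup" and ?K = "Poly_Mapping.keys \<gamma>"
  define N where "N = Max (insert 0 (?lk \<gamma> ` ?K))"
  define B where "B = {f. \<forall>k. (k \<in> ?K \<longrightarrow> f k \<in> {..N}) \<and> (k \<notin> ?K \<longrightarrow> f k = 0)}"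
  have "finite B"
    unfolding B_def by (rule finite_set_of_finite_funs) auto
  moreover have "inj ?lk"
    by (rule injI) (simp only: poly_mapping_eq_iff)
  ultimately have fin: "finite (?lk -` B)"
    by (rule finite_vimageI)
  have N: "?lk \<gamma> k \<le> N" if "k \<in> ?K" for k
    unfolding N_def by (rule Max_ge) (use that in auto)
  have mem: "?lk \<delta> \<in> B" if "\<And>k. ?lk \<delta> k \<le> ?lk \<gamma> k" for \<delta> :: multiindex
    unfolding B_def
  proof (intro CollectI allI conjI impI)
    fix k
    show "?lk \<delta> k \<in> {..N}" if "k \<in> ?K"
      using N[OF that] \<open>?lk \<delta> k \<le> ?lk \<gamma> k\<close> by simp
    show "?lk \<delta> k = 0" if "k \<notin> ?K"
      using that \<open>?lk \<delta> k \<le> ?lk \<gamma> k\<close> by (simp add: in_keys_iff)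
  qed
  have "x \<in> (?lk -` B) \<times> (?lk -` B)" if "x \<in> {(\<alpha>, \<beta>). \<alpha> + \<beta> = \<gamma>}" for x
  proof -
    obtain \<alpha> \<beta> where x: "x = (\<alpha>, \<beta>)" and ab: "\<alpha> + \<beta> = \<gamma>"
      using \<open>x \<in> {(\<alpha>, \<beta>). \<alpha> + \<beta> = \<gamma>}\<close> by blast
    have "?lk \<alpha> \<in> B" by (rule mem) (simp add: lookup_add flip: ab)
    moreover have "?lk \<beta> \<in> B" by (rule mem) (simp add: lookup_add flip: ab)
    ultimately show ?thesis using x by simp
  qed
  then have "{(\<alpha>, \<beta>). \<alpha> + \<beta> = \<gamma>} \<subseteq> (?lk -` B) \<times> (?lk -` B)"
    by (rule subsetI)
  then show ?thesis
    by (rule finite_subset) (intro finite_cartesian_product fin)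
qed

text \<open>In the coefficient equations the total zeroth order term is the coefficient of
  the Wick product of the potential and the solution.\<close>

lemma propagator_force_wick:
  "propagator_force R F U \<gamma> t - Linf_mult (R 0) (U \<gamma> t) =
     F \<gamma> t - wick Linf_mult R (\<lambda>\<beta>. U \<beta> t) \<gamma>"
proof -
  let ?A = "{(\<alpha>::multiindex, \<beta>). \<alpha> + \<beta> = \<gamma>}"
  let ?B = "{(\<alpha>::multiindex, \<beta>). \<alpha> + \<beta> = \<gamma> \<and> \<alpha> \<noteq> 0}"
  let ?h = "\<lambda>(\<alpha>, \<beta>). Linf_mult (R \<alpha>) (U \<beta> t)"
  have A: "?A = insert (0, \<gamma>) ?B" by auto
  have "finite ?B"
    by (rule finite_subset[OF _ finite_multiindex_decompositions[of \<gamma>]]) auto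
  then have w: "wick Linf_mult R (\<lambda>\<beta>. U \<beta> t) \<gamma> = Linf_mult (R 0) (U \<gamma> t) + sum ?h ?B"
    unfolding wick_def A by (subst sum.insert) auto
  show ?thesis
  proof (cases "\<gamma> = 0")
    case True
    have "?B = {}"
    proof -
      have "\<alpha> = 0" if "\<alpha> + \<beta> = \<gamma>" for \<alpha> \<beta> :: multiindex
      proof -
        have "Poly_Mapping.lookup \<alpha> k + Poly_Mapping.lookup \<beta> k = 0" for k
          using True that by (metis lookup_add lookup_zero)
        then show ?thesis by (intro poly_mapping_eqI) simp
      qed
      then show ?thesis by auto
    qed
    then have "sum ?h ?B = 0" by (simp only: sum.empty)
    then show ?thesis using True w by (simp add: propagator_force_def)
  next
    case False
    then show ?thesis using w by (simp add: propagator_force_def)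
  qed
qed

end

theory Submission
  imports Defs
begin

text \<open>
  The coefficients \<open>d\<^sub>\<gamma>\<close> of the difference between a regularized solution and \<open>V\<close> satisfy, by
  Duhamel's formula for both solutions, a linear Volterra equation with zero initial value. Its
  integrand is, up to the sign and the action of the semigroup, the sum over \<open>\<alpha> + \<beta> = \<gamma>\<close> of
  \<open>q\<^sub>\<alpha>\<^sup>\<epsilon> d\<^sub>\<beta>\<close> and of the defects \<open>(q\<^sub>\<alpha>\<^sup>\<epsilon> - q\<^sub>\<alpha>) v\<^sub>\<beta>\<close>.
  Everything rests on two facts: the equation is stable uniformly in \<open>\<epsilon>\<close>, and the defects vanish in the
  limit.

  Stability. All the coefficients \<open>q\<^sub>\<alpha>\<^sup>\<epsilon>\<close> are bounded by the same constant \<open>K\<close>, because averaging with a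
  mollifier does not increase the essential supremum. In a supremum norm with the exponential weight
  \<open>exp (- \<rho> t)\<close> the integration in time costs only a factor of order \<open>1 / \<rho>\<close>
  (lemma \<open>weighted_coefficient_difference\<close>). Across the indices, the Kondratiev weights are
  multiplicative and summable, so in the weighted \<open>l\<^sup>1\<close> norm the convolution over \<open>\<alpha> + \<beta> = \<gamma>\<close> is a
  bounded operation, and for large \<open>\<rho>\<close> the term with \<open>d\<^sub>\<beta>\<close> is absorbed into the left hand side
  (lemma \<open>weighted_convolution_absorption\<close>). The weighted \<open>l\<^sup>1\<close> norm dominates the Kondratiev norm, and
  it is thus bounded by a constant times the weighted sum over all pairs \<open>(\<alpha>, \<beta>)\<close> of the defects.

  Vanishing of the defects. For a single pair, multiplication with \<open>q\<^sub>\<alpha>\<^sup>\<epsilon>\<close> converges strongly on \<open>L\<^sup>2\<close>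
  to multiplication with \<open>q\<^sub>\<alpha>\<close>, by continuity of translations in \<open>L\<^sup>1\<close>
  (lemma \<open>Linf_mult_mollified_tendsto\<close>). As the operators are uniformly bounded and the trajectory of
  \<open>v\<^sub>\<beta>\<close> is compact, the convergence is uniform in time. The defect of a pair is at most \<open>2 K\<close> times the
  norm of \<open>v\<^sub>\<beta>\<close>, which grows at most like a power of the weight since \<open>V\<close> is a Kondratiev process; with
  \<open>p\<close> large enough this dominates the double sum, and the limit may be taken term by term.
\<close>

section \<open>Continuity of translations in the mean\<close>

lemma nn_integral_lborel_shift:
  fixes g :: "'a::euclidean_space \<Rightarrow> ennreal"
  assumes [measurable]: "g \<in> borel_measurable borel"
  shows "(\<integral>\<^sup>+x. g (x - h) \<partial>lborel) = (\<integral>\<^sup>+x. g x \<partial>lborel)"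
proof -
  have "(\<integral>\<^sup>+x. g x \<partial>lborel) = (\<integral>\<^sup>+x. g x \<partial>distr lborel borel ((+) (- h)))"
    by (simp only: lborel_distr_plus)
  also have "\<dots> = (\<integral>\<^sup>+x. g (x - h) \<partial>lborel)"
    by (subst nn_integral_distr) auto
  finally show ?thesis ..
qed

text \<open>The translates are compared through the extended nonnegative integral, so that no integrability
  has to be established before two functions are compared.\<close>

definition L1_translation_continuous ::
  "('a::euclidean_space \<Rightarrow> 'b::{banach,second_countable_topology}) \<Rightarrow> bool" where
  "L1_translation_continuous f \<longleftrightarrow>
     (\<forall>e>0. \<forall>\<^sub>F h in nhds 0. (\<integral>\<^sup>+x. ennreal (norm (f (x - h) - f x)) \<partial>lborel) \<le> ennreal e)"

text \<open>Translation is an isometry for the \<open>L\<^sup>1\<close> distance, so continuity passes to limits by the usual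
  argument with three thirds.\<close>

lemma L1_translation_continuous_approx:
  fixes f :: "'a::euclidean_space \<Rightarrow> 'b::{banach,second_countable_topology}"
  assumes [measurable]: "f \<in> borel_measurable borel"
    and approx: "\<And>e. e > 0 \<Longrightarrow> \<exists>g\<in>borel_measurable borel. L1_translation_continuous g \<and>
                   (\<integral>\<^sup>+x. ennreal (norm (f x - g x)) \<partial>lborel) \<le> ennreal e"
  shows "L1_translation_continuous f"
  unfolding L1_translation_continuous_def
proof (intro allI impI)
  fix e :: real assume "e > 0"
  then have e3: "e / 3 > 0" by simp
  obtain g :: "'a \<Rightarrow> 'b" where [measurable]: "g \<in> borel_measurable borel"
    and g: "L1_translation_continuous g"
    and fg: "(\<integral>\<^sup>+x. ennreal (norm (f x - g x)) \<partial>lborel) \<le> ennreal (e / 3)"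
    using approx[OF e3] by blast
  from g e3 have "\<forall>\<^sub>F h in nhds 0. (\<integral>\<^sup>+x. ennreal (norm (g (x - h) - g x)) \<partial>lborel) \<le> ennreal (e / 3)"
    unfolding L1_translation_continuous_def by blast
  then show "\<forall>\<^sub>F h in nhds 0. (\<integral>\<^sup>+x. ennreal (norm (f (x - h) - f x)) \<partial>lborel) \<le> ennreal e"
  proof eventually_elim
    case (elim h)
    have "(\<integral>\<^sup>+x. ennreal (norm (f (x - h) - f x)) \<partial>lborel)
        \<le> (\<integral>\<^sup>+x. ennreal (norm (f (x - h) - g (x - h))) + ennreal (norm (g (x - h) - g x))
              + ennreal (norm (f x - g x)) \<partial>lborel)"
    proof (rule nn_integral_mono)
      fix x
      have "norm (f (x - h) - f x)
          \<le> norm (f (x - h) - g (x - h)) + norm (g (x - h) - g x) + norm (f x - g x)"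
        using norm_triangle_ineq[of "f (x - h) - g (x - h)" "g (x - h) - g x"]
          norm_triangle_ineq4[of "f (x - h) - g x" "f x - g x"] by simp
      then show "ennreal (norm (f (x - h) - f x)) \<le> ennreal (norm (f (x - h) - g (x - h)))
          + ennreal (norm (g (x - h) - g x)) + ennreal (norm (f x - g x))"
        by (simp flip: ennreal_plus)
    qed
    also have "\<dots> = (\<integral>\<^sup>+x. ennreal (norm (f (x - h) - g (x - h))) \<partial>lborel)
        + (\<integral>\<^sup>+x. ennreal (norm (g (x - h) - g x)) \<partial>lborel)
        + (\<integral>\<^sup>+x. ennreal (norm (f x - g x)) \<partial>lborel)"
      by (subst nn_integral_add; simp)+
    also have "(\<integral>\<^sup>+x. ennreal (norm (f (x - h) - g (x - h))) \<partial>lborel)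
        = (\<integral>\<^sup>+x. ennreal (norm (f x - g x)) \<partial>lborel)"
      by (rule nn_integral_lborel_shift) measurable
    also have "\<dots> + (\<integral>\<^sup>+x. ennreal (norm (g (x - h) - g x)) \<partial>lborel)
        + (\<integral>\<^sup>+x. ennreal (norm (f x - g x)) \<partial>lborel)
        \<le> ennreal (e / 3) + ennreal (e / 3) + ennreal (e / 3)"
      using fg elim by (intro add_mono)
    also have "\<dots> = ennreal e"
      using \<open>e > 0\<close> by (simp flip: ennreal_plus)
    finally show ?case .
  qed
qed

text \<open>A point of an open set stays in it under small translations. By dominated convergence the part of
  \<open>U\<close> that a translation moves out of \<open>U\<close> has small measure; the part that it moves into \<open>U\<close> from
  outside is the translate of such a set for the opposite translation.\<close>

lemma L1_translation_continuous_open: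
  fixes U :: "'a::euclidean_space set" and c :: "'b::{banach,second_countable_topology}"
  assumes U: "open U" and fin: "emeasure lborel U < \<infinity>"
  shows "L1_translation_continuous (\<lambda>x. indicator U x *\<^sub>R c)"
  unfolding L1_translation_continuous_def
proof (intro allI impI)
  fix e :: real assume "e > 0"
  have [measurable]: "U \<in> sets borel" using U by simp
  \<comment> \<open>The indicator of the points of \<open>U\<close> that the translation takes out of \<open>U\<close>.\<close>
  define g :: "'a \<Rightarrow> 'a \<Rightarrow> ennreal" where "g h x = indicator U x * indicator (- U) (x - h)" for h x
  have g[measurable]: "g h \<in> borel_measurable borel" for h
    unfolding g_def by measurable
  have lim: "(\<lambda>n. \<integral>\<^sup>+x. g (h n) x \<partial>lborel) \<longlonglongrightarrow> 0" if h: "h \<longlonglongrightarrow> 0" for h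
  proof -
    have "(\<lambda>n. \<integral>\<^sup>+x. g (h n) x \<partial>lborel) \<longlonglongrightarrow> (\<integral>\<^sup>+x. 0 \<partial>(lborel :: 'a measure))"
    proof (rule nn_integral_dominated_convergence)
      show "AE x in lborel. g (h n) x \<le> indicator U x" for n
        by (auto simp: g_def indicator_def)
      show "(\<integral>\<^sup>+x. indicator U x \<partial>lborel) < \<infinity>"
        using fin by simp
      show "AE x in lborel. (\<lambda>n. g (h n) x) \<longlonglongrightarrow> 0"
      proof (rule AE_I2)
        fix x
        show "(\<lambda>n. g (h n) x) \<longlonglongrightarrow> 0"
        proof (cases "x \<in> U")
          case True
          have "(\<lambda>n. x - h n) \<longlonglongrightarrow> x - 0"
            by (intro tendsto_intros h)
          then have "\<forall>\<^sub>F n in sequentially. x - h n \<in> U"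
            using U True by (simp add: topological_tendstoD)
          then have "\<forall>\<^sub>F n in sequentially. g (h n) x = 0"
            by eventually_elim (simp add: g_def)
          then show ?thesis
            by (rule tendsto_eventually)
        qed (simp add: g_def)
      qed
    qed auto
    then show ?thesis by simp
  qed
  define J where "J h = ennreal (norm c) * ((\<integral>\<^sup>+x. g h x \<partial>lborel) + (\<integral>\<^sup>+x. g (- h) x \<partial>lborel))" for h
  have le: "(\<integral>\<^sup>+x. ennreal (norm (indicator U (x - h) *\<^sub>R c - indicator U x *\<^sub>R c)) \<partial>lborel) \<le> J h"
    for h :: 'a
  proof -
    have "(\<integral>\<^sup>+x. ennreal (norm (indicator U (x - h) *\<^sub>R c - indicator U x *\<^sub>R c)) \<partial>lborel)
        \<le> (\<integral>\<^sup>+x. ennreal (norm c) * (g h x + g (- h) (x - h)) \<partial>lborel)"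
      \<comment> \<open>A point \<open>x\<close> outside \<open>U\<close> with \<open>x - h\<close> in \<open>U\<close> is counted by \<open>g (- h)\<close> at \<open>x - h\<close>.\<close>
      by (rule nn_integral_mono) (auto simp: g_def indicator_def)
    also have "\<dots> = ennreal (norm c) * ((\<integral>\<^sup>+x. g h x \<partial>lborel) + (\<integral>\<^sup>+x. g (- h) (x - h) \<partial>lborel))"
      by (subst nn_integral_cmult, measurable, subst nn_integral_add) auto
    also have "(\<integral>\<^sup>+x. g (- h) (x - h) \<partial>lborel) = (\<integral>\<^sup>+x. g (- h) x \<partial>lborel)"
      by (rule nn_integral_lborel_shift) measurable
    finally show ?thesis by (simp add: J_def)
  qed
  have Jlim: "(\<lambda>n. J (h n)) \<longlonglongrightarrow> 0" if h: "h \<longlonglongrightarrow> 0" for h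
  proof -
    have "(\<lambda>n. - h n) \<longlonglongrightarrow> 0" using tendsto_minus[OF h] by simp
    then have "(\<lambda>n. J (h n)) \<longlonglongrightarrow> ennreal (norm c) * (0 + 0)"
      unfolding J_def using lim[OF h] lim[of "\<lambda>n. - h n"]
      by (intro ennreal_tendsto_cmult tendsto_add) auto
    then show ?thesis by simp
  qed
  have g0: "g 0 x = 0" for x
    by (simp add: g_def indicator_def)
  have "\<forall>\<^sub>F h in at 0 within UNIV. J h < ennreal e"
  proof (rule sequentially_imp_eventually_within, intro allI impI)
    fix h :: "nat \<Rightarrow> 'a"
    assume "(\<forall>n. h n \<in> UNIV \<and> h n \<noteq> 0) \<and> h \<longlonglongrightarrow> 0"
    then show "\<forall>\<^sub>F n in sequentially. J (h n) < ennreal e"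
      using Jlim[of h] \<open>e > 0\<close> by (intro order_tendstoD(2)) auto
  qed
  moreover have "J 0 < ennreal e"
    using \<open>e > 0\<close> g0 by (simp add: J_def)
  ultimately have "\<forall>\<^sub>F h in nhds 0. J h < ennreal e"
    by (simp add: eventually_nhds_conv_at)
  then show "\<forall>\<^sub>F h in nhds 0.
      (\<integral>\<^sup>+x. ennreal (norm (indicator U (x - h) *\<^sub>R c - indicator U x *\<^sub>R c)) \<partial>lborel) \<le> ennreal e"
    by eventually_elim (use le in \<open>meson less_imp_le order_trans\<close>)
qed

text \<open>Indicators of sets of finite measure are approximated by those of open sets (outer regularity);
  sums and dominated limits then give all integrable functions.\<close>

lemma L1_translation_continuous_integrable:
  fixes f :: "'a::euclidean_space \<Rightarrow> 'b::{banach,second_countable_topology}"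
  assumes "integrable lborel f"
  shows "L1_translation_continuous f"
  using assms
proof (induction rule: integrable_induct)
  case (base A c)
  then have [measurable]: "A \<in> sets borel" by simp
  show ?case
  proof (rule L1_translation_continuous_approx)
    fix e :: real assume "e > 0"
    define r where "r = e / (norm c + 1)"
    have "r > 0" using \<open>e > 0\<close> by (simp add: r_def add_nonneg_pos)
    obtain U where U: "open U" "A \<subseteq> U" "emeasure lborel (U - A) < ennreal r"
      using outer_regular_lborel[of A r] \<open>r > 0\<close> by auto
    have [measurable]: "U \<in> sets borel" using U by simp
    have "emeasure lborel U = emeasure lborel A + emeasure lborel (U - A)"
      using U by (subst plus_emeasure) (auto intro!: arg_cong[where f = "emeasure lborel"])
    also have "\<dots> < \<infinity>" using base(2) U(3) by (simp add: less_top order.strict_trans)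
    finally have fin: "emeasure lborel U < \<infinity>" .
    have "(\<integral>\<^sup>+x. ennreal (norm (indicator A x *\<^sub>R c - indicator U x *\<^sub>R c)) \<partial>lborel)
        = (\<integral>\<^sup>+x. ennreal (norm c) * indicator (U - A) x \<partial>lborel)"
      using U(2) by (intro nn_integral_cong) (auto simp: indicator_def)
    also have "\<dots> = ennreal (norm c) * emeasure lborel (U - A)"
      by (rule nn_integral_cmult_indicator) simp
    also have "\<dots> \<le> ennreal (norm c) * ennreal r"
      using U(3) by (intro mult_left_mono) auto
    also have "\<dots> = ennreal (norm c * r)"
      using \<open>r > 0\<close> by (simp add: ennreal_mult)
    also have "norm c * r \<le> e"
    proof -
      have "norm c * r \<le> (norm c + 1) * r" using \<open>r > 0\<close> by simp
      also have "\<dots> = e" by (simp add: r_def add_nonneg_pos less_imp_neq[symmetric])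
      finally show ?thesis .
    qed
    finally have "(\<integral>\<^sup>+x. ennreal (norm (indicator A x *\<^sub>R c - indicator U x *\<^sub>R c)) \<partial>lborel) \<le> ennreal e"
      by (simp add: ennreal_leI)
    then show "\<exists>g\<in>borel_measurable borel. L1_translation_continuous g \<and>
        (\<integral>\<^sup>+x. ennreal (norm (indicator A x *\<^sub>R c - g x)) \<partial>lborel) \<le> ennreal e"
      using L1_translation_continuous_open[OF U(1) fin, of c]
      by (intro bexI[of _ "\<lambda>x. indicator U x *\<^sub>R c"]) auto
  qed simp
next
  case (add f g)
  have [measurable]: "f \<in> borel_measurable borel" "g \<in> borel_measurable borel"
    using add by (auto dest: borel_measurable_integrable)
  show ?case
    unfolding L1_translation_continuous_def
  proof (intro allI impI)
    fix e :: real assume "e > 0"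
    then have e2: "e / 2 > 0" by simp
    have "\<forall>\<^sub>F h in nhds 0. (\<integral>\<^sup>+x. ennreal (norm (f (x - h) - f x)) \<partial>lborel) \<le> ennreal (e / 2)"
      "\<forall>\<^sub>F h in nhds 0. (\<integral>\<^sup>+x. ennreal (norm (g (x - h) - g x)) \<partial>lborel) \<le> ennreal (e / 2)"
      using add e2 unfolding L1_translation_continuous_def by blast+
    then show "\<forall>\<^sub>F h in nhds 0.
        (\<integral>\<^sup>+x. ennreal (norm (f (x - h) + g (x - h) - (f x + g x))) \<partial>lborel) \<le> ennreal e"
    proof eventually_elim
      case (elim h)
      have "(\<integral>\<^sup>+x. ennreal (norm (f (x - h) + g (x - h) - (f x + g x))) \<partial>lborel)
          \<le> (\<integral>\<^sup>+x. ennreal (norm (f (x - h) - f x)) + ennreal (norm (g (x - h) - g x)) \<partial>lborel)"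
        by (intro nn_integral_mono)
          (simp add: norm_diff_triangle_ineq flip: ennreal_plus)
      also have "\<dots> = (\<integral>\<^sup>+x. ennreal (norm (f (x - h) - f x)) \<partial>lborel)
          + (\<integral>\<^sup>+x. ennreal (norm (g (x - h) - g x)) \<partial>lborel)"
        by (rule nn_integral_add) auto
      also have "\<dots> \<le> ennreal (e / 2) + ennreal (e / 2)"
        using elim by (intro add_mono)
      also have "\<dots> = ennreal e" using \<open>e > 0\<close> by (simp flip: ennreal_plus)
      finally show ?case .
    qed
  qed
next
  case (lim f s)
  have f[measurable]: "f \<in> borel_measurable borel" and s[measurable]: "s i \<in> borel_measurable borel" for i
    using lim by (auto dest: borel_measurable_integrable)
  have "(\<lambda>i. \<integral>\<^sup>+x. ennreal (norm (f x - s i x)) \<partial>lborel) \<longlonglongrightarrow> (\<integral>\<^sup>+x. 0 \<partial>(lborel :: 'a measure))"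
  proof (rule nn_integral_dominated_convergence)
    show "AE x in lborel. ennreal (norm (f x - s i x)) \<le> ennreal (3 * norm (f x))" for i
    proof (rule AE_I2)
      fix x
      have "norm (f x - s i x) \<le> norm (f x) + norm (s i x)" by (rule norm_triangle_ineq4)
      also have "norm (s i x) \<le> 2 * norm (f x)" using lim.hyps(3) by simp
      finally show "ennreal (norm (f x - s i x)) \<le> ennreal (3 * norm (f x))"
        by (simp add: ennreal_leI)
    qed
    show "(\<integral>\<^sup>+x. ennreal (3 * norm (f x)) \<partial>lborel) < \<infinity>"
      using lim.hyps(4) by (simp add: ennreal_mult nn_integral_cmult integrable_iff_bounded ennreal_mult_less_top)
    show "AE x in lborel. (\<lambda>i. ennreal (norm (f x - s i x))) \<longlonglongrightarrow> 0"
    proof (rule AE_I2)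
      fix x
      have "(\<lambda>i. norm (f x - s i x)) \<longlonglongrightarrow> norm (f x - f x)"
        using lim.hyps(2)[of x] by (intro tendsto_intros) auto
      then show "(\<lambda>i. ennreal (norm (f x - s i x))) \<longlonglongrightarrow> 0"
        using tendsto_ennrealI by fastforce
    qed
  qed auto
  then have conv: "(\<lambda>i. \<integral>\<^sup>+x. ennreal (norm (f x - s i x)) \<partial>lborel) \<longlonglongrightarrow> 0" by simp
  show ?case
  proof (rule L1_translation_continuous_approx[OF f])
    fix e :: real assume "e > 0"
    then have "\<forall>\<^sub>F i in sequentially. (\<integral>\<^sup>+x. ennreal (norm (f x - s i x)) \<partial>lborel) < ennreal e"
      using conv by (intro order_tendstoD(2)) auto
    then obtain i where "(\<integral>\<^sup>+x. ennreal (norm (f x - s i x)) \<partial>lborel) < ennreal e"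
      by (auto dest: eventually_happens)
    then show "\<exists>g\<in>borel_measurable borel. L1_translation_continuous g \<and>
        (\<integral>\<^sup>+x. ennreal (norm (f x - g x)) \<partial>lborel) \<le> ennreal e"
      using lim.IH s by (intro bexI[of _ "s i"]) (auto simp: less_imp_le)
  qed
qed

section \<open>Multiplication by mollified bounded functions\<close>

lemma integral_lborel_affine:
  fixes g :: "'a::euclidean_space \<Rightarrow> 'b::{banach,second_countable_topology}"
  assumes [measurable]: "g \<in> borel_measurable borel" and "c \<noteq> 0"
  shows "(LINT x|lborel. g x) = \<bar>c\<bar> ^ DIM('a) *\<^sub>R (LINT x|lborel. g (t + c *\<^sub>R x))"
  by (subst lborel_affine[OF assms(2), of t])
     (simp add: integral_density integral_distr)

lemma AE_lborel_affine:
  fixes t :: "'a::euclidean_space"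
  assumes "AE x in lborel. P x" and [measurable]: "Measurable.pred borel P" and "c \<noteq> 0"
  shows "AE x in lborel. P (t + c *\<^sub>R x)"
proof -
  have "AE x in density (distr lborel borel (\<lambda>x. t + c *\<^sub>R x)) (\<lambda>_. \<bar>c\<bar>^DIM('a)). P x"
    using assms(1) by (subst (asm) lborel_affine[OF assms(3), of t])
  then show ?thesis
    using assms(3) by (simp add: AE_density AE_distr_iff)
qed

lemma AE_norm_le_Linf_norm:
  assumes "r \<in> Linf"
  shows "AE x in lborel. norm (r x) \<le> Linf_norm r"
proof -
  let ?e = "esssup lborel (\<lambda>x. ereal (norm (r x)))"
  have "AE x in lborel. ereal (norm (r x)) \<le> ?e"
    by (rule esssup_AE)
  then show ?thesis
  proof eventually_elim
    case (elim x)
    then show ?case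
      using assms by (cases ?e) (auto simp: Linf_def Linf_norm_def)
  qed
qed

lemma LinfI:
  assumes [measurable]: "r \<in> borel_measurable lborel" and "AE x in lborel. norm (r x) \<le> K"
  shows "r \<in> Linf"
proof -
  have "esssup lborel (\<lambda>x. ereal (norm (r x))) \<le> ereal K"
    using assms(2) by (intro esssup_I) auto
  then show ?thesis
    by (auto simp: Linf_def intro: le_less_trans)
qed

text \<open>One representative serves all norms that occur below. This turns statements about classes into
  statements about integrals without unfolding the quotient again.\<close>

lemma L2_representative:
  fixes u :: "('a::euclidean_space, 'b::{real_normed_field,banach,second_countable_topology}) L2"
  obtains h where "square_integrable h" "norm u = sqrt (LINT x|lborel. (norm (h x))\<^sup>2)"
    "\<And>r. r \<in> Linf \<Longrightarrow> norm (Linf_mult r u) = sqrt (LINT x|lborel. (norm (r x * h x))\<^sup>2)"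
    "\<And>r r'. r \<in> Linf \<Longrightarrow> r' \<in> Linf \<Longrightarrow>
       norm (Linf_mult r u - Linf_mult r' u) = sqrt (LINT x|lborel. (norm (r x * h x - r' x * h x))\<^sup>2)"
proof -
  obtain h where h: "L2_rel h h" and u: "u = abs_L2 h"
    using Quotient_L2 by (metis Quotient_def)
  have sq: "square_integrable h" using h by (simp add: L2_rel_def)
  have rel: "L2_rel g g" if "square_integrable g" for g :: "'a \<Rightarrow> 'b"
    using that by (simp add: L2_rel_def)
  have mult: "Linf_mult r u = abs_L2 (\<lambda>x. r x * h x)" if "r \<in> Linf" for r
    using that h unfolding u by (simp add: Linf_mult.abs_eq)
  show thesis
  proof (rule that[OF sq])
    show "norm u = sqrt (LINT x|lborel. (norm (h x))\<^sup>2)"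
      unfolding u using h by (simp add: norm_L2.abs_eq)
    show "norm (Linf_mult r u) = sqrt (LINT x|lborel. (norm (r x * h x))\<^sup>2)" if "r \<in> Linf" for r
      using that sq by (simp add: mult norm_L2.abs_eq rel square_integrable_Linf_mult)
    show "norm (Linf_mult r u - Linf_mult r' u) = sqrt (LINT x|lborel. (norm (r x * h x - r' x * h x))\<^sup>2)"
      if "r \<in> Linf" "r' \<in> Linf" for r r'
      using that sq
      by (simp add: mult norm_L2.abs_eq minus_L2.abs_eq rel square_integrable_Linf_mult square_integrable_diff)
  qed
qed

lemma norm_Linf_mult_le:
  fixes u :: "('a::euclidean_space, 'b::{real_normed_field,banach,second_countable_topology}) L2"
  assumes "r \<in> Linf" and K: "AE x in lborel. norm (r x) \<le> K" "K \<ge> 0"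
  shows "norm (Linf_mult r u) \<le> K * norm u"
proof -
  obtain h where h: "square_integrable h" and nu: "norm u = sqrt (LINT x|lborel. (norm (h x))\<^sup>2)"
    and nr: "norm (Linf_mult r u) = sqrt (LINT x|lborel. (norm (r x * h x))\<^sup>2)"
    using L2_representative[of u] \<open>r \<in> Linf\<close> by metis
  have "(LINT x|lborel. (norm (r x * h x))\<^sup>2) \<le> (LINT x|lborel. K\<^sup>2 * (norm (h x))\<^sup>2)"
  proof (rule integral_mono_AE)
    show "integrable lborel (\<lambda>x. (norm (r x * h x))\<^sup>2)"
      using square_integrable_Linf_mult[OF \<open>r \<in> Linf\<close> h] by (simp add: square_integrable_def)
    show "integrable lborel (\<lambda>x. K\<^sup>2 * (norm (h x))\<^sup>2)"
      using h by (simp add: square_integrable_def)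
    show "AE x in lborel. (norm (r x * h x))\<^sup>2 \<le> K\<^sup>2 * (norm (h x))\<^sup>2"
      using K(1) by eventually_elim (simp add: norm_mult power_mult_distrib mult_right_mono power_mono)
  qed
  also have "\<dots> = K\<^sup>2 * (LINT x|lborel. (norm (h x))\<^sup>2)" by simp
  finally have "sqrt (LINT x|lborel. (norm (r x * h x))\<^sup>2) \<le> sqrt (K\<^sup>2 * (LINT x|lborel. (norm (h x))\<^sup>2))"
    by simp
  then show ?thesis
    using K(2) by (simp add: nr nu real_sqrt_mult)
qed

lemma Linf_mult_diff_right:
  assumes "r \<in> Linf"
  shows "Linf_mult r (u - v) = Linf_mult r u - Linf_mult r v"
  using assms
  by transfer (auto simp: L2_rel_def square_integrable_Linf_mult square_integrable_diff algebra_simps)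

text \<open>The function \<open>q\<close> itself need not be integrable, but \<open>q H\<close> and \<open>H\<close> are. Since
  \<open>(q (x - y) - q x) H x = ((q H) (x - y) - (q H) x) - (H (x - y) - H x) q (x - y)\<close>,
  translation continuity of these two functions controls the difference.\<close>

lemma weighted_L1_translation:
  fixes q :: "'a::euclidean_space \<Rightarrow> 'b::{banach,second_countable_topology}" and H :: "'a \<Rightarrow> real"
  assumes [measurable]: "q \<in> borel_measurable borel" and K: "AE x in lborel. norm (q x) \<le> K" "K \<ge> 0"
    and H: "integrable lborel H" "\<And>x. H x \<ge> 0" and "e > 0"
  shows "\<forall>\<^sub>F y in nhds 0. (\<integral>\<^sup>+x. ennreal (norm (q (x - y) - q x) * H x) \<partial>lborel) \<le> ennreal e"
proof -
  have [measurable]: "H \<in> borel_measurable borel" using H(1) by auto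
  have qH: "integrable lborel (\<lambda>x. H x *\<^sub>R q x)"
  proof (rule Bochner_Integration.integrable_bound)
    show "integrable lborel (\<lambda>x. K * H x)" using H(1) by simp
    show "AE x in lborel. norm (H x *\<^sub>R q x) \<le> norm (K * H x)"
      using K(1) by eventually_elim (use K(2) H(2) in \<open>simp add: abs_mult mult.commute[of K] mult_left_mono\<close>)
  qed measurable
  define e1 where "e1 = e / 2"
  define e2 where "e2 = e / (2 * (K + 1))"
  have e12: "e1 > 0" "e2 > 0" using \<open>e > 0\<close> K(2) by (simp_all add: e1_def e2_def)
  have "\<forall>\<^sub>F y in nhds 0. (\<integral>\<^sup>+x. ennreal (norm (H (x - y) *\<^sub>R q (x - y) - H x *\<^sub>R q x)) \<partial>lborel) \<le> ennreal e1"
    using L1_translation_continuous_integrable[OF qH] e12(1)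
    unfolding L1_translation_continuous_def by blast
  moreover have "\<forall>\<^sub>F y in nhds 0. (\<integral>\<^sup>+x. ennreal (norm (H (x - y) - H x)) \<partial>lborel) \<le> ennreal e2"
    using L1_translation_continuous_integrable[OF H(1)] e12(2)
    unfolding L1_translation_continuous_def by blast
  ultimately show ?thesis
  proof eventually_elim
    case (elim y)
    have AEy: "AE x in lborel. norm (q (x - y)) \<le> K"
      using AE_lborel_affine[OF K(1), where t = "- y" and c = 1] by (simp add: add.commute)
    have "(\<integral>\<^sup>+x. ennreal (norm (q (x - y) - q x) * H x) \<partial>lborel)
       \<le> (\<integral>\<^sup>+x. ennreal (norm (H (x - y) *\<^sub>R q (x - y) - H x *\<^sub>R q x))
             + ennreal K * ennreal (norm (H (x - y) - H x)) \<partial>lborel)"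
    proof (rule nn_integral_mono_AE)
      show "AE x in lborel. ennreal (norm (q (x - y) - q x) * H x)
          \<le> ennreal (norm (H (x - y) *\<^sub>R q (x - y) - H x *\<^sub>R q x))
             + ennreal K * ennreal (norm (H (x - y) - H x))"
        using AEy
      proof eventually_elim
        case (elim x)
        have "norm (q (x - y) - q x) * H x = norm (H x *\<^sub>R (q (x - y) - q x))"
          using H(2) by simp
        also have "H x *\<^sub>R (q (x - y) - q x)
            = (H (x - y) *\<^sub>R q (x - y) - H x *\<^sub>R q x) - (H (x - y) - H x) *\<^sub>R q (x - y)"
          by (simp add: algebra_simps)
        also have "norm \<dots> \<le> norm (H (x - y) *\<^sub>R q (x - y) - H x *\<^sub>R q x)
            + norm ((H (x - y) - H x) *\<^sub>R q (x - y))"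
          by (rule norm_triangle_ineq4)
        also have "norm ((H (x - y) - H x) *\<^sub>R q (x - y)) \<le> K * norm (H (x - y) - H x)"
          using elim by (simp add: mult.commute[of K] mult_left_mono)
        finally show ?case
          using K(2) by (simp flip: ennreal_plus ennreal_mult)
      qed
    qed
    also have "\<dots> = (\<integral>\<^sup>+x. ennreal (norm (H (x - y) *\<^sub>R q (x - y) - H x *\<^sub>R q x)) \<partial>lborel)
        + ennreal K * (\<integral>\<^sup>+x. ennreal (norm (H (x - y) - H x)) \<partial>lborel)"
      by (subst nn_integral_add, simp, simp, subst nn_integral_cmult) auto
    also have "\<dots> \<le> ennreal e1 + ennreal K * ennreal e2"
      using elim by (intro add_mono mult_left_mono) auto
    also have "\<dots> = ennreal (e1 + K * e2)"
      using e12 K(2) by (simp add: ennreal_mult)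
    also have "\<dots> \<le> ennreal e"
    proof (rule ennreal_leI)
      have "K * e2 \<le> (K + 1) * e2" using e12 by simp
      also have "\<dots> = e / 2" using K(2) by (simp add: e2_def field_simps)
      finally show "e1 + K * e2 \<le> e" by (simp add: e1_def)
    qed
    finally show ?case .
  qed
qed

lemma mollifierD:
  assumes "mollifier \<phi>"
  shows "\<phi> \<in> borel_measurable borel" "integrable lborel \<phi>" "\<phi> x \<ge> 0" "(LINT x|lborel. \<phi> x) = 1"
    "(\<integral>\<^sup>+x. ennreal (\<phi> x) \<partial>lborel) = 1" "\<exists>R>0. \<forall>x. \<phi> x \<noteq> 0 \<longrightarrow> norm x \<le> R"
proof -
  have "C_k 0 \<phi>" using assms unfolding mollifier_def by blast
  then show "\<phi> \<in> borel_measurable borel"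
    by (auto intro: borel_measurable_continuous_onI)
  show nn: "\<phi> x \<ge> 0" for x using assms by (simp add: mollifier_def)
  show one: "(LINT x|lborel. \<phi> x) = 1" using assms by (simp add: mollifier_def)
  then show int: "integrable lborel \<phi>"
    using not_integrable_integral_eq by fastforce
  show "(\<integral>\<^sup>+x. ennreal (\<phi> x) \<partial>lborel) = 1"
    using nn_integral_eq_integral[OF int] nn one by simp
  have "bounded {x. \<phi> x \<noteq> 0}"
    using assms by (simp add: mollifier_def)
  then show "\<exists>R>0. \<forall>x. \<phi> x \<noteq> 0 \<longrightarrow> norm x \<le> R"
    unfolding bounded_pos by blast
qed

text \<open>Every regularization in a mollifying net is the member with scale \<open>l\<close> of the net whose scale is
  the parameter itself, so that limits need only be taken for \<open>l \<rightarrow> 0\<close>.\<close>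

abbreviation mollified ::
  "('a::euclidean_space \<Rightarrow> 'b::{banach,second_countable_topology}) \<Rightarrow> ('a \<Rightarrow> real) \<Rightarrow> real \<Rightarrow> 'a \<Rightarrow> 'b" where
  "mollified q \<phi> l \<equiv> convolve q (mollifying_net \<phi> (\<lambda>l. l) l)"

text \<open>The scale sits in the argument of \<open>q\<close> here, which presents the mollification as a weighted average
  of translates of \<open>q\<close>.\<close>

lemma mollified_eq:
  fixes q :: "'a::euclidean_space \<Rightarrow> 'b::{banach,second_countable_topology}"
  assumes [measurable]: "\<phi> \<in> borel_measurable borel" "q \<in> borel_measurable borel" and "l > 0"
  shows "mollified q \<phi> l x = (LINT z|lborel. \<phi> z *\<^sub>R q (x - l *\<^sub>R z))"
proof -
  have "mollified q \<phi> l x = (LINT y|lborel. (\<phi> ((x - y) /\<^sub>R l) / l ^ DIM('a)) *\<^sub>R q y)"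
    by (simp add: convolve_def mollifying_net_def)
  also have "\<dots> = l ^ DIM('a) *\<^sub>R (LINT z|lborel. (\<phi> z / l ^ DIM('a)) *\<^sub>R q (x - l *\<^sub>R z))"
    using \<open>l > 0\<close> by (subst integral_lborel_affine[where t = x and c = "- l"]) auto
  also have "(LINT z|lborel. (\<phi> z / l ^ DIM('a)) *\<^sub>R q (x - l *\<^sub>R z))
      = (LINT z|lborel. inverse (l ^ DIM('a)) *\<^sub>R (\<phi> z *\<^sub>R q (x - l *\<^sub>R z)))"
    by (simp add: divide_inverse mult.commute)
  also have "\<dots> = inverse (l ^ DIM('a)) *\<^sub>R (LINT z|lborel. \<phi> z *\<^sub>R q (x - l *\<^sub>R z))"
    by (rule integral_scaleR_right)
  also have "l ^ DIM('a) *\<^sub>R \<dots> = (LINT z|lborel. \<phi> z *\<^sub>R q (x - l *\<^sub>R z))"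
    using \<open>l > 0\<close> by simp
  finally show ?thesis .
qed

lemma mollified_integrand:
  fixes q :: "'a::euclidean_space \<Rightarrow> 'b::{banach,second_countable_topology}"
  assumes \<phi>: "mollifier \<phi>" and [measurable]: "q \<in> borel_measurable borel"
    and K: "AE x in lborel. norm (q x) \<le> K" and "l > 0"
  shows "integrable lborel (\<lambda>z. \<phi> z *\<^sub>R q (x - l *\<^sub>R z))"
    "norm (mollified q \<phi> l x) \<le> K"
proof -
  have [measurable]: "\<phi> \<in> borel_measurable borel" using mollifierD(1)[OF \<phi>] .
  have AEx: "AE z in lborel. norm (q (x - l *\<^sub>R z)) \<le> K"
    using AE_lborel_affine[OF K, where t = x and c = "- l"] \<open>l > 0\<close> by simp
  have AEb: "AE z in lborel. norm (\<phi> z *\<^sub>R q (x - l *\<^sub>R z)) \<le> K * \<phi> z"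
    using AEx by eventually_elim (use mollifierD(3)[OF \<phi>] in \<open>simp add: mult.commute[of K] mult_left_mono\<close>)
  have intK: "integrable lborel (\<lambda>z. K * \<phi> z)" using mollifierD(2)[OF \<phi>] by simp
  show int: "integrable lborel (\<lambda>z. \<phi> z *\<^sub>R q (x - l *\<^sub>R z))"
    by (rule Bochner_Integration.integrable_bound[OF intK])
      (measurable, use AEb in eventually_elim, auto)
  have "norm (mollified q \<phi> l x) = norm (LINT z|lborel. \<phi> z *\<^sub>R q (x - l *\<^sub>R z))"
    using \<open>l > 0\<close> by (simp add: mollified_eq)
  also have "\<dots> \<le> (LINT z|lborel. norm (\<phi> z *\<^sub>R q (x - l *\<^sub>R z)))"
    by (rule integral_norm_bound)
  also have "\<dots> \<le> (LINT z|lborel. K * \<phi> z)"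
    using AEb by (intro integral_mono_AE integrable_norm int intK)
  also have "\<dots> = K" using mollifierD(4)[OF \<phi>] by simp
  finally show "norm (mollified q \<phi> l x) \<le> K" .
qed

lemma mollified_measurable:
  fixes q :: "'a::euclidean_space \<Rightarrow> 'b::{banach,second_countable_topology}"
  assumes \<phi>: "mollifier \<phi>" and [measurable]: "q \<in> borel_measurable borel"
  shows "mollified q \<phi> l \<in> borel_measurable borel"
proof -
  have [measurable]: "\<phi> \<in> borel_measurable borel" using mollifierD(1)[OF \<phi>] .
  show ?thesis
    unfolding convolve_def mollifying_net_def by measurable
qed

text \<open>By Tonelli's theorem the weighted distance is at most the \<open>\<phi>\<close>-average over \<open>z\<close> of the weighted
  distances between \<open>q\<close> and its translate by \<open>l z\<close>. The support of \<open>\<phi>\<close> is bounded, so all these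
  translations are uniformly small.\<close>

lemma mollified_weighted_L1:
  fixes q :: "'a::euclidean_space \<Rightarrow> 'b::{banach,second_countable_topology}" and H :: "'a \<Rightarrow> real"
  assumes \<phi>: "mollifier \<phi>" and [measurable]: "q \<in> borel_measurable borel"
    and K: "AE x in lborel. norm (q x) \<le> K" "K \<ge> 0"
    and H: "integrable lborel H" "\<And>x. H x \<ge> 0" and "e > 0"
  shows "\<forall>\<^sub>F l in at_right 0.
    (\<integral>\<^sup>+x. ennreal (norm (mollified q \<phi> l x - q x) * H x) \<partial>lborel) \<le> ennreal e"
proof -
  have [measurable]: "\<phi> \<in> borel_measurable borel" using mollifierD(1)[OF \<phi>] .
  have [measurable]: "H \<in> borel_measurable borel" using H(1) by auto
  have "\<forall>\<^sub>F y in nhds 0. (\<integral>\<^sup>+x. ennreal (norm (q (x - y) - q x) * H x) \<partial>lborel) \<le> ennreal e"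
    by (rule weighted_L1_translation[OF _ K H \<open>e > 0\<close>]) measurable
  then obtain \<delta> where \<delta>: "\<delta> > 0"
    "\<And>y. norm y < \<delta> \<Longrightarrow> (\<integral>\<^sup>+x. ennreal (norm (q (x - y) - q x) * H x) \<partial>lborel) \<le> ennreal e"
    unfolding eventually_nhds_metric by (auto simp: dist_norm)
  obtain R where R: "R > 0" "\<And>z. \<phi> z \<noteq> 0 \<Longrightarrow> norm z \<le> R"
    using mollifierD(6)[OF \<phi>] by blast
  have "\<forall>\<^sub>F l in at_right 0. (l::real) \<in> {0<..<\<delta> / R}"
    using \<delta>(1) R(1) by (intro eventually_at_right_real) simp
  then show ?thesis
  proof eventually_elim
    case (elim l)
    then have l: "l > 0" "l * R < \<delta>" using R(1) by (auto simp: field_simps)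
    have "(\<integral>\<^sup>+x. ennreal (norm (mollified q \<phi> l x - q x) * H x) \<partial>lborel)
        \<le> (\<integral>\<^sup>+x. (\<integral>\<^sup>+z. ennreal (\<phi> z) * ennreal (norm (q (x - l *\<^sub>R z) - q x) * H x) \<partial>lborel) \<partial>lborel)"
    proof (rule nn_integral_mono)
      fix x
      note int = mollified_integrand(1)[OF \<phi> _ K(1) l(1), of x]
      have int2: "integrable lborel (\<lambda>z. \<phi> z *\<^sub>R q (x - l *\<^sub>R z) - \<phi> z *\<^sub>R q x)"
        using int mollifierD(2)[OF \<phi>] by (intro Bochner_Integration.integrable_diff) auto
      have "mollified q \<phi> l x - q x = (LINT z|lborel. \<phi> z *\<^sub>R q (x - l *\<^sub>R z)) - (LINT z|lborel. \<phi> z *\<^sub>R q x)"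
        using mollifierD(2,4)[OF \<phi>] l(1) by (simp add: mollified_eq)
      also have "\<dots> = (LINT z|lborel. \<phi> z *\<^sub>R q (x - l *\<^sub>R z) - \<phi> z *\<^sub>R q x)"
        using int mollifierD(2)[OF \<phi>] by (intro Bochner_Integration.integral_diff[symmetric]) auto
      finally have "ennreal (norm (mollified q \<phi> l x - q x))
          \<le> (\<integral>\<^sup>+z. ennreal (norm (\<phi> z *\<^sub>R q (x - l *\<^sub>R z) - \<phi> z *\<^sub>R q x)) \<partial>lborel)"
        using integral_norm_bound_ennreal[OF int2] by simp
      then have "ennreal (norm (mollified q \<phi> l x - q x)) * ennreal (H x)
          \<le> (\<integral>\<^sup>+z. ennreal (norm (\<phi> z *\<^sub>R q (x - l *\<^sub>R z) - \<phi> z *\<^sub>R q x)) \<partial>lborel) * ennreal (H x)"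
        by (rule mult_right_mono) simp
      also have "\<dots> = (\<integral>\<^sup>+z. ennreal (norm (\<phi> z *\<^sub>R q (x - l *\<^sub>R z) - \<phi> z *\<^sub>R q x)) * ennreal (H x) \<partial>lborel)"
        by (rule nn_integral_multc[symmetric]) measurable
      also have "\<dots> = (\<integral>\<^sup>+z. ennreal (\<phi> z) * ennreal (norm (q (x - l *\<^sub>R z) - q x) * H x) \<partial>lborel)"
        using mollifierD(3)[OF \<phi>] H(2)
        by (intro nn_integral_cong) (simp add: mult.assoc flip: ennreal_mult scaleR_diff_right)
      finally show "ennreal (norm (mollified q \<phi> l x - q x) * H x)
          \<le> (\<integral>\<^sup>+z. ennreal (\<phi> z) * ennreal (norm (q (x - l *\<^sub>R z) - q x) * H x) \<partial>lborel)"
        using H(2) by (simp add: ennreal_mult)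
    qed
    also have "\<dots> = (\<integral>\<^sup>+z. (\<integral>\<^sup>+x. ennreal (\<phi> z) * ennreal (norm (q (x - l *\<^sub>R z) - q x) * H x) \<partial>lborel) \<partial>lborel)"
      by (rule lborel_pair.Fubini') measurable
    also have "\<dots> \<le> (\<integral>\<^sup>+z. ennreal (\<phi> z) * ennreal e \<partial>lborel)"
    proof (rule nn_integral_mono)
      fix z
      have "(\<integral>\<^sup>+x. ennreal (\<phi> z) * ennreal (norm (q (x - l *\<^sub>R z) - q x) * H x) \<partial>lborel)
          = ennreal (\<phi> z) * (\<integral>\<^sup>+x. ennreal (norm (q (x - l *\<^sub>R z) - q x) * H x) \<partial>lborel)"
        by (rule nn_integral_cmult) measurable
      also have "\<dots> \<le> ennreal (\<phi> z) * ennreal e"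
      proof (cases "\<phi> z = 0")
        case False
        have "norm (l *\<^sub>R z) \<le> l * R"
          using R(2)[OF False] l(1) by simp
        also have "\<dots> < \<delta>" by (rule l(2))
        finally show ?thesis by (intro mult_left_mono \<delta>(2)) auto
      qed simp
      finally show "(\<integral>\<^sup>+x. ennreal (\<phi> z) * ennreal (norm (q (x - l *\<^sub>R z) - q x) * H x) \<partial>lborel)
          \<le> ennreal (\<phi> z) * ennreal e" .
    qed
    also have "\<dots> = ennreal e"
      using mollifierD(5)[OF \<phi>] by (simp add: nn_integral_multc)
    finally show ?case .
  qed
qed

text \<open>The mollified potentials need not converge in \<open>L\<^sup>\<infinity>\<close>, but as multiplication operators they
  converge strongly: both factors are bounded by \<open>K\<close>, so one power of their difference can be
  sacrificed, and what remains is a distance weighted with the integrable function \<open>|h|\<^sup>2\<close>.\<close>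

lemma Linf_mult_mollified_tendsto:
  fixes q :: "'a::euclidean_space \<Rightarrow> 'b::{real_normed_field,banach,second_countable_topology}"
  assumes \<phi>: "mollifier \<phi>" and q: "q \<in> Linf"
  shows "((\<lambda>l. Linf_mult (mollified q \<phi> l) u) \<longlongrightarrow> Linf_mult q u) (at_right 0)"
proof -
  have [measurable]: "q \<in> borel_measurable borel" using q by (simp add: Linf_def)
  define K where "K = max 0 (Linf_norm q)"
  have K: "AE x in lborel. norm (q x) \<le> K" "K \<ge> 0"
    using AE_norm_le_Linf_norm[OF q] by (auto simp: K_def elim: eventually_mono)
  obtain h where h: "square_integrable h"
    and nd: "\<And>r r'. r \<in> Linf \<Longrightarrow> r' \<in> Linf \<Longrightarrow>
       norm (Linf_mult r u - Linf_mult r' u) = sqrt (LINT x|lborel. (norm (r x * h x - r' x * h x))\<^sup>2)"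
    by (rule L2_representative[of u]) (rule that)
  define H where "H x = (norm (h x))\<^sup>2" for x
  have H: "integrable lborel H" "\<And>x. H x \<ge> 0" and [measurable]: "h \<in> borel_measurable borel"
    using h by (auto simp: square_integrable_def H_def[abs_def])
  have [measurable]: "H \<in> borel_measurable borel" using H by auto
  show ?thesis
    unfolding tendsto_iff
  proof (intro allI impI)
    fix e :: real assume "e > 0"
    define e' where "e' = e\<^sup>2 / (2 * (2 * K + 1))"
    have "e' > 0" using \<open>e > 0\<close> K(2) by (simp add: e'_def)
    have "\<forall>\<^sub>F l in at_right 0. (l::real) \<in> {0<..<1}"
      by (intro eventually_at_right_real) simp
    moreover have "\<forall>\<^sub>F l in at_right 0.
        (\<integral>\<^sup>+x. ennreal (norm (mollified q \<phi> l x - q x) * H x) \<partial>lborel) \<le> ennreal e'"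
      by (rule mollified_weighted_L1[OF \<phi> _ K H \<open>e' > 0\<close>]) measurable
    ultimately show "\<forall>\<^sub>F l in at_right 0. dist (Linf_mult (mollified q \<phi> l) u) (Linf_mult q u) < e"
    proof (rule eventually_elim2)
      fix l :: real
      assume l: "l \<in> {0<..<1}"
        and small: "(\<integral>\<^sup>+x. ennreal (norm (mollified q \<phi> l x - q x) * H x) \<partial>lborel) \<le> ennreal e'"
      let ?r = "mollified q \<phi> l"
      have [measurable]: "?r \<in> borel_measurable borel"
        by (rule mollified_measurable[OF \<phi>]) simp
      have bd: "norm (?r x) \<le> K" for x
        using mollified_integrand(2)[OF \<phi> _ K(1), of l x] l by simp
      have rL: "?r \<in> Linf"
        using bd by (intro LinfI[where K = K]) auto
      have "ennreal (LINT x|lborel. (norm (?r x * h x - q x * h x))\<^sup>2)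
          = (\<integral>\<^sup>+x. ennreal ((norm (?r x * h x - q x * h x))\<^sup>2) \<partial>lborel)"
        using square_integrable_diff[OF square_integrable_Linf_mult[OF rL h] square_integrable_Linf_mult[OF q h]]
        by (intro nn_integral_eq_integral[symmetric]) (auto simp: square_integrable_def)
      also have "\<dots> \<le> (\<integral>\<^sup>+x. ennreal (2 * K) * ennreal (norm (?r x - q x) * H x) \<partial>lborel)"
      proof (rule nn_integral_mono_AE)
        show "AE x in lborel. ennreal ((norm (?r x * h x - q x * h x))\<^sup>2)
            \<le> ennreal (2 * K) * ennreal (norm (?r x - q x) * H x)"
          using K(1)
        proof eventually_elim
          case (elim x)
          have "norm (?r x - q x) \<le> 2 * K"
            using norm_triangle_ineq4[of "?r x" "q x"] bd[of x] elim by simp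
          then have "norm (?r x - q x) * (norm (?r x - q x) * H x) \<le> 2 * K * (norm (?r x - q x) * H x)"
            using H(2) by (intro mult_right_mono) auto
          moreover have "(norm (?r x * h x - q x * h x))\<^sup>2 = norm (?r x - q x) * (norm (?r x - q x) * H x)"
          proof -
            have "?r x * h x - q x * h x = (?r x - q x) * h x" by (simp add: left_diff_distrib)
            then show ?thesis by (simp only: norm_mult H_def power2_eq_square mult_ac)
          qed
          ultimately show ?case
            using K(2) H(2) by (simp add: ennreal_leI flip: ennreal_mult)
        qed
      qed
      also have "\<dots> = ennreal (2 * K) * (\<integral>\<^sup>+x. ennreal (norm (?r x - q x) * H x) \<partial>lborel)"
        by (rule nn_integral_cmult) measurable
      also have "\<dots> \<le> ennreal (2 * K) * ennreal e'"
        using small by (rule mult_left_mono) simp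
      also have "\<dots> = ennreal (2 * K * e')"
        using K(2) \<open>e' > 0\<close> by (simp add: ennreal_mult)
      finally have "(LINT x|lborel. (norm (?r x * h x - q x * h x))\<^sup>2) \<le> 2 * K * e'"
        using K(2) \<open>e' > 0\<close> by simp
      also have "\<dots> \<le> (2 * K + 1) * e'" using \<open>e' > 0\<close> by simp
      also have "\<dots> = e\<^sup>2 / 2" using K(2) by (simp add: e'_def field_simps)
      also have "\<dots> < e\<^sup>2" using \<open>e > 0\<close> by simp
      finally have "norm (Linf_mult ?r u - Linf_mult q u) < sqrt (e\<^sup>2)"
        unfolding nd[OF rL q] by (rule real_sqrt_less_mono)
      then show "dist (Linf_mult ?r u) (Linf_mult q u) < e"
        using \<open>e > 0\<close> by (simp add: dist_norm)
    qed
  qed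
qed

lemma continuous_on_Linf_mult:
  assumes r: "r \<in> Linf" and f: "continuous_on A f"
  shows "continuous_on A (\<lambda>t. Linf_mult r (f t))"
proof -
  define K where "K = max 0 (Linf_norm r)"
  have K: "AE x in lborel. norm (r x) \<le> K" "K \<ge> 0"
    using AE_norm_le_Linf_norm[OF r] by (auto simp: K_def elim: eventually_mono)
  have "K-lipschitz_on UNIV (Linf_mult r)"
    using norm_Linf_mult_le[OF r K] K(2)
    by (intro lipschitz_onI) (simp_all add: dist_norm Linf_mult_diff_right[OF r, symmetric])
  then show ?thesis
    using continuous_on_compose2[OF lipschitz_on_continuous_on f] by blast
qed

section \<open>Weights on multi-indices and convolution sums\<close>

lemma two_N_pow_superset:
  assumes "finite A" "Poly_Mapping.keys \<gamma> \<subseteq> A"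
  shows "two_N_pow r \<gamma> = (\<Prod>k\<in>A. (2 * real (k + 1)) powr (r * real (Poly_Mapping.lookup \<gamma> k)))"
  unfolding two_N_pow_def
  using assms by (intro prod.mono_neutral_left) (auto simp: in_keys_iff)

lemma two_N_pow_pos: "two_N_pow r \<gamma> > 0"
  unfolding two_N_pow_def by (intro prod_pos) auto

lemma two_N_pow_nonneg: "two_N_pow r \<gamma> \<ge> 0"
  using two_N_pow_pos[of r \<gamma>] by simp

lemma two_N_pow_add_index: "two_N_pow r (\<alpha> + \<beta>) = two_N_pow r \<alpha> * two_N_pow r \<beta>"
proof -
  let ?A = "Poly_Mapping.keys \<alpha> \<union> Poly_Mapping.keys \<beta>"
  have "Poly_Mapping.keys (\<alpha> + \<beta>) \<subseteq> ?A" by (rule Poly_Mapping.keys_add)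
  then show ?thesis
    by (simp add: two_N_pow_superset[of ?A] lookup_add powr_add distrib_left flip: prod.distrib)
qed

lemma two_N_pow_add_exponent: "two_N_pow (r + s) \<gamma> = two_N_pow r \<gamma> * two_N_pow s \<gamma>"
  unfolding two_N_pow_def by (simp add: powr_add distrib_right flip: prod.distrib)

lemma two_N_pow_mono: "r \<le> s \<Longrightarrow> two_N_pow r \<gamma> \<le> two_N_pow s \<gamma>"
  unfolding two_N_pow_def by (intro prod_mono) (auto intro!: powr_mono mult_right_mono)

text \<open>On multi-indices with bounded support and bounded entries the sum factors into geometric sums, hence
  it is at most the Wallis product of the factors \<open>1 / (1 - 1 / (2 m)\<^sup>2)\<close>.\<close>

lemma sum_two_N_pow_le_2:
  assumes "finite A"
  shows "(\<Sum>\<gamma>\<in>A. two_N_pow (-2) \<gamma>) \<le> 2"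
proof -
  define n where "n = Suc (Max (insert 0 (\<Union>\<gamma>\<in>A. Poly_Mapping.keys \<gamma>)))"
  define N where "N = Max (insert 0 (\<Union>\<gamma>\<in>A. Poly_Mapping.lookup \<gamma> ` Poly_Mapping.keys \<gamma>))"
  have n: "Poly_Mapping.keys \<gamma> \<subseteq> {..<n}" if "\<gamma> \<in> A" for \<gamma>
    unfolding n_def using that assms by (auto simp: less_Suc_eq_le intro!: Max_ge)
  have N: "Poly_Mapping.lookup \<gamma> k \<le> N" if "\<gamma> \<in> A" for \<gamma> k
  proof (cases "k \<in> Poly_Mapping.keys \<gamma>")
    case True
    then show ?thesis
      unfolding N_def using that assms by (intro Max_ge) auto
  qed (simp add: in_keys_iff)
  define x :: "nat \<Rightarrow> real" where "x k = 1 / (4 * (real (k + 1))\<^sup>2)" for k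
  have x: "0 < x k" "x k < 1" for k
  proof -
    have "(real (k + 1))\<^sup>2 \<ge> 1\<^sup>2" by (intro power_mono) auto
    then have "4 * (real (k + 1))\<^sup>2 > 1" by (simp only: one_power2)
    then show "0 < x k" "x k < 1" unfolding x_def by (auto simp del: of_nat_add)
  qed
  have powr_x: "(2 * real (k + 1)) powr (- 2 * real j) = x k ^ j" for k j
  proof -
    have "(2 * real (k + 1)) powr (- 2 * real j) = ((2 * real (k + 1)) powr (- 2)) powr real j"
      by (simp add: powr_powr)
    also have "(2 * real (k + 1)) powr (- 2) = x k"
      by (simp add: powr_minus x_def power2_eq_square divide_inverse algebra_simps)
    also have "x k powr real j = x k ^ j"
      using x by (simp add: powr_realpow)
    finally show ?thesis .
  qed
  let ?rho = "\<lambda>\<gamma>. restrict (Poly_Mapping.lookup \<gamma>) {..<n}"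
  have inj: "inj_on ?rho A"
  proof (rule inj_onI)
    fix \<gamma> \<delta> assume gd: "\<gamma> \<in> A" "\<delta> \<in> A" "?rho \<gamma> = ?rho \<delta>"
    show "\<gamma> = \<delta>"
    proof (rule poly_mapping_eqI)
      fix k
      show "Poly_Mapping.lookup \<gamma> k = Poly_Mapping.lookup \<delta> k"
      proof (cases "k < n")
        case True
        then show ?thesis using fun_cong[OF gd(3), of k] by simp
      next
        case False
        then have "k \<notin> Poly_Mapping.keys \<gamma>" "k \<notin> Poly_Mapping.keys \<delta>"
          using n gd by blast+
        then show ?thesis by (simp add: in_keys_iff)
      qed
    qed
  qed
  have "(\<Sum>\<gamma>\<in>A. two_N_pow (-2) \<gamma>) = (\<Sum>\<gamma>\<in>A. \<Prod>k<n. x k ^ ?rho \<gamma> k)"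
    using n by (intro sum.cong) (simp_all add: two_N_pow_superset[of "{..<n}"] powr_x[simplified])
  also have "\<dots> = (\<Sum>f\<in>?rho ` A. \<Prod>k<n. x k ^ f k)"
    by (simp add: sum.reindex[OF inj])
  also have "\<dots> \<le> (\<Sum>f\<in>PiE {..<n} (\<lambda>_. {..N}). \<Prod>k<n. x k ^ f k)"
  proof (rule sum_mono2)
    show "?rho ` A \<subseteq> PiE {..<n} (\<lambda>_. {..N})"
      using N by (intro image_subsetI) (simp add: restrict_PiE_iff)
  qed (use x in \<open>auto intro!: finite_PiE prod_nonneg simp: less_imp_le\<close>)
  also have "\<dots> = (\<Prod>k<n. \<Sum>j\<le>N. x k ^ j)"
    by (rule prod_sum_PiE[symmetric]) auto
  also have "\<dots> \<le> (\<Prod>k<n. 1 / (1 - x k))"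
  proof (rule prod_mono)
    fix k
    have nx: "norm (x k) < 1" and nn: "x k ^ j \<ge> 0" for j
      using x[of k] by (auto simp: abs_if)
    have "(\<Sum>j\<le>N. x k ^ j) \<le> suminf (\<lambda>j. x k ^ j)"
      by (rule sum_le_suminf[OF summable_geometric[OF nx]]) (simp_all add: nn)
    also have "\<dots> = 1 / (1 - x k)" by (rule suminf_geometric[OF nx])
    finally show "0 \<le> (\<Sum>j\<le>N. x k ^ j) \<and> (\<Sum>j\<le>N. x k ^ j) \<le> 1 / (1 - x k)"
      by (simp add: sum_nonneg nn)
  qed
  \<comment> \<open>The correction term makes the bound on the partial Wallis products inductive.\<close>
  also have "\<dots> \<le> 2 - 1 / real (n + 1)"
  proof (induction n)
    case (Suc n)
    define m where "m = real (n + 1)"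
    have m: "m \<ge> 1" by (simp add: m_def)
    have pos: "4 * m\<^sup>2 - 1 > 0" using one_le_power[OF m, of 2] by linarith
    have "(\<Prod>k<Suc n. 1 / (1 - x k)) = (\<Prod>k<n. 1 / (1 - x k)) * (1 / (1 - x n))" by simp
    also have "\<dots> \<le> (2 - 1 / m) * (1 / (1 - x n))"
      using Suc.IH x[of n] by (intro mult_right_mono) (auto simp: m_def)
    also have "1 / (1 - x n) = 4 * m\<^sup>2 / (4 * m\<^sup>2 - 1)"
      unfolding x_def m_def[symmetric] using m pos by (simp add: divide_simps)
    also have "4 * m\<^sup>2 - 1 = (2 * m - 1) * (2 * m + 1)"
      by (simp add: power2_eq_square algebra_simps)
    also have "(2 - 1 / m) * (4 * m\<^sup>2 / ((2 * m - 1) * (2 * m + 1))) = 4 * m / (2 * m + 1)"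
    proof -
      have "2 - 1 / m = (2 * m - 1) / m" using m by (simp add: field_simps)
      moreover have "2 * m - 1 \<noteq> 0" using m by simp
      ultimately show ?thesis using m by (simp add: power2_eq_square)
    qed
    also have "\<dots> \<le> 2 - 1 / (m + 1)"
    proof -
      have "2 - 1 / (m + 1) - 4 * m / (2 * m + 1) = 1 / ((m + 1) * (2 * m + 1))"
        using m by (simp add: divide_simps) (simp add: algebra_simps)
      also have "\<dots> \<ge> 0" using m by simp
      finally show ?thesis by linarith
    qed
    finally show ?case by (simp add: m_def add_ac)
  qed simp
  also have "\<dots> \<le> 2" by simp
  finally show ?thesis .
qed

lemma sum_two_N_pow_le:
  assumes "r \<le> - 2" "finite A"
  shows "(\<Sum>\<gamma>\<in>A. two_N_pow r \<gamma>) \<le> 2"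
  using sum_mono[of A "two_N_pow r" "two_N_pow (-2)"] two_N_pow_mono[OF assms(1)]
    sum_two_N_pow_le_2[OF assms(2)]
  by fastforce

lemma summable_two_N_pow_product:
  assumes "r \<le> - 2" "s \<le> - 2"
  shows "(\<lambda>(\<alpha>, \<beta>). two_N_pow r \<alpha> * two_N_pow s \<beta>) summable_on UNIV"
proof (rule nonneg_bdd_above_summable_on)
  have "(\<Sum>(\<alpha>, \<beta>)\<in>A. two_N_pow r \<alpha> * two_N_pow s \<beta>) \<le> 2 * 2" if "finite A" for A
  proof -
    have "(\<Sum>(\<alpha>, \<beta>)\<in>A. two_N_pow r \<alpha> * two_N_pow s \<beta>)
        \<le> (\<Sum>(\<alpha>, \<beta>)\<in>fst ` A \<times> snd ` A. two_N_pow r \<alpha> * two_N_pow s \<beta>)"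
      using that by (intro sum_mono2) (force simp: two_N_pow_nonneg)+
    also have "\<dots> = (\<Sum>\<alpha>\<in>fst ` A. two_N_pow r \<alpha>) * (\<Sum>\<beta>\<in>snd ` A. two_N_pow s \<beta>)"
      by (simp add: sum_product sum.cartesian_product)
    also have "\<dots> \<le> 2 * 2"
      using that assms by (intro mult_mono sum_two_N_pow_le sum_nonneg)
        (auto simp: two_N_pow_nonneg)
    finally show ?thesis .
  qed
  then show "bdd_above (sum (\<lambda>(\<alpha>, \<beta>). two_N_pow r \<alpha> * two_N_pow s \<beta>) ` {A. A \<subseteq> UNIV \<and> finite A})"
    by (auto simp: bdd_above_def)
qed (auto simp: two_N_pow_nonneg)

lemma sum_antidiagonals_le:
  fixes c :: "multiindex \<Rightarrow> multiindex \<Rightarrow> real"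
  assumes "finite \<Gamma>" and nn: "\<And>\<alpha> \<beta>. c \<alpha> \<beta> \<ge> 0"
    and down: "\<And>\<alpha> \<beta>. \<alpha> + \<beta> \<in> \<Gamma> \<Longrightarrow> \<alpha> \<in> \<Gamma> \<and> \<beta> \<in> \<Gamma>"
  shows "(\<Sum>\<gamma>\<in>\<Gamma>. \<Sum>(\<alpha>, \<beta>)\<in>{(\<alpha>, \<beta>). \<alpha> + \<beta> = \<gamma>}. c \<alpha> \<beta>) \<le> (\<Sum>(\<alpha>, \<beta>)\<in>\<Gamma> \<times> \<Gamma>. c \<alpha> \<beta>)"
proof -
  have "(\<Sum>\<gamma>\<in>\<Gamma>. \<Sum>(\<alpha>, \<beta>)\<in>{(\<alpha>, \<beta>). \<alpha> + \<beta> = \<gamma>}. c \<alpha> \<beta>)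
      = (\<Sum>(\<alpha>, \<beta>)\<in>(\<Union>\<gamma>\<in>\<Gamma>. {(\<alpha>, \<beta>). \<alpha> + \<beta> = \<gamma>}). c \<alpha> \<beta>)"
    using \<open>finite \<Gamma>\<close> finite_multiindex_decompositions
    by (intro sum.UNION_disjoint[symmetric]) auto
  also have "\<dots> \<le> (\<Sum>(\<alpha>, \<beta>)\<in>\<Gamma> \<times> \<Gamma>. c \<alpha> \<beta>)"
  proof (rule sum_mono2)
    show "(\<Union>\<gamma>\<in>\<Gamma>. {(\<alpha>, \<beta>). \<alpha> + \<beta> = \<gamma>}) \<subseteq> \<Gamma> \<times> \<Gamma>"
      using down by blast
  qed (use \<open>finite \<Gamma>\<close> nn in \<open>auto simp: case_prod_unfold\<close>)
  finally show ?thesis .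
qed

text \<open>The convolution recursions below couple an index only to its summands, so they close up on finite
  sets that contain all summands of their elements.\<close>

lemma finite_downset:
  assumes "finite (A :: multiindex set)"
  obtains \<Gamma> where "finite \<Gamma>" "A \<subseteq> \<Gamma>" "\<And>\<alpha> \<beta>. \<alpha> + \<beta> \<in> \<Gamma> \<Longrightarrow> \<alpha> \<in> \<Gamma> \<and> \<beta> \<in> \<Gamma>"
proof (rule that)
  let ?G = "\<Union>\<gamma>\<in>A. fst ` {(\<alpha>, \<beta>). \<alpha> + \<beta> = \<gamma>}"
  show "finite ?G"
    using assms finite_multiindex_decompositions by auto
  show "A \<subseteq> ?G"
    by (force intro: image_eqI[where x = "(_, 0)"])
  show "\<alpha> \<in> ?G \<and> \<beta> \<in> ?G" if "\<alpha> + \<beta> \<in> ?G" for \<alpha> \<beta>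
  proof -
    from that obtain \<gamma> \<delta> where "\<gamma> \<in> A" "\<alpha> + \<beta> + \<delta> = \<gamma>" by auto
    moreover from this have "(\<alpha>, \<beta> + \<delta>) \<in> {(\<alpha>, \<beta>). \<alpha> + \<beta> = \<gamma>}" "(\<beta>, \<alpha> + \<delta>) \<in> {(\<alpha>, \<beta>). \<alpha> + \<beta> = \<gamma>}"
      by (auto simp: ac_simps)
    ultimately show ?thesis by force
  qed
qed

text \<open>A discrete Young inequality with absorption. The weight is multiplicative, so weighting turns the
  convolution over \<open>\<alpha> + \<beta> = \<gamma>\<close> into a product of sums; if \<open>\<kappa>\<close> is small, the part of the right hand
  side with \<open>d\<close> is at most half of the left hand side. The sum must be known to be finite before it can
  be absorbed, therefore the estimate is made on finite sets closed under taking summands. Its bound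
  does not depend on the set.\<close>

lemma weighted_convolution_absorption:
  fixes \<theta> d :: "multiindex \<Rightarrow> real" and W :: "multiindex \<Rightarrow> multiindex \<Rightarrow> real"
  assumes \<theta>: "\<And>\<alpha>. \<theta> \<alpha> \<ge> 0" "\<And>\<alpha> \<beta>. \<theta> (\<alpha> + \<beta>) = \<theta> \<alpha> * \<theta> \<beta>"
      "\<And>A. finite A \<Longrightarrow> (\<Sum>\<alpha>\<in>A. \<theta> \<alpha>) \<le> B"
    and d: "\<And>\<gamma>. d \<gamma> \<ge> 0"
      "\<And>\<gamma>. d \<gamma> \<le> \<kappa> * (\<Sum>(\<alpha>, \<beta>)\<in>{(\<alpha>, \<beta>). \<alpha> + \<beta> = \<gamma>}. K * d \<beta> + W \<alpha> \<beta>)"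
    and W: "\<And>\<alpha> \<beta>. W \<alpha> \<beta> \<ge> 0" "(\<lambda>(\<alpha>, \<beta>). \<theta> \<alpha> * \<theta> \<beta> * W \<alpha> \<beta>) summable_on UNIV"
    and \<kappa>: "\<kappa> \<ge> 0" "K \<ge> 0" "\<kappa> * (K * B) \<le> 1 / 2"
    and A: "finite A"
  shows "(\<Sum>\<gamma>\<in>A. \<theta> \<gamma> * d \<gamma>) \<le> 2 * \<kappa> * (\<Sum>\<^sub>\<infinity>(\<alpha>, \<beta>). \<theta> \<alpha> * \<theta> \<beta> * W \<alpha> \<beta>)"
proof -
  obtain \<Gamma> where \<Gamma>: "finite \<Gamma>" "A \<subseteq> \<Gamma>" "\<And>\<alpha> \<beta>. \<alpha> + \<beta> \<in> \<Gamma> \<Longrightarrow> \<alpha> \<in> \<Gamma> \<and> \<beta> \<in> \<Gamma>"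
    using finite_downset[OF A] by blast
  define X where "X = (\<Sum>\<gamma>\<in>\<Gamma>. \<theta> \<gamma> * d \<gamma>)"
  define Y where "Y = (\<Sum>\<^sub>\<infinity>(\<alpha>, \<beta>). \<theta> \<alpha> * \<theta> \<beta> * W \<alpha> \<beta>)"
  have X0: "X \<ge> 0" unfolding X_def using \<theta> d by (intro sum_nonneg) auto
  have "X \<le> (\<Sum>\<gamma>\<in>\<Gamma>. \<theta> \<gamma> * (\<kappa> * (\<Sum>(\<alpha>, \<beta>)\<in>{(\<alpha>, \<beta>). \<alpha> + \<beta> = \<gamma>}. K * d \<beta> + W \<alpha> \<beta>)))"
    unfolding X_def using \<theta> d by (intro sum_mono mult_left_mono) auto
  also have "\<dots> = \<kappa> * (\<Sum>\<gamma>\<in>\<Gamma>. \<Sum>(\<alpha>, \<beta>)\<in>{(\<alpha>, \<beta>). \<alpha> + \<beta> = \<gamma>}.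
      K * (\<theta> \<alpha> * (\<theta> \<beta> * d \<beta>)) + \<theta> \<alpha> * \<theta> \<beta> * W \<alpha> \<beta>)"
    unfolding sum_distrib_left
    by (intro sum.cong refl) (auto simp: \<theta>(2) algebra_simps)
  also have "\<dots> \<le> \<kappa> * (\<Sum>(\<alpha>, \<beta>)\<in>\<Gamma> \<times> \<Gamma>. K * (\<theta> \<alpha> * (\<theta> \<beta> * d \<beta>)) + \<theta> \<alpha> * \<theta> \<beta> * W \<alpha> \<beta>)"
    using \<theta>(1) d(1) W(1) \<kappa>(1,2) by (intro mult_left_mono sum_antidiagonals_le \<Gamma>) auto
  also have "(\<Sum>(\<alpha>, \<beta>)\<in>\<Gamma> \<times> \<Gamma>. K * (\<theta> \<alpha> * (\<theta> \<beta> * d \<beta>)) + \<theta> \<alpha> * \<theta> \<beta> * W \<alpha> \<beta>)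
      = K * (\<Sum>\<alpha>\<in>\<Gamma>. \<theta> \<alpha>) * X + (\<Sum>(\<alpha>, \<beta>)\<in>\<Gamma> \<times> \<Gamma>. \<theta> \<alpha> * \<theta> \<beta> * W \<alpha> \<beta>)"
    unfolding X_def
    by (simp add: sum.distrib sum_distrib_left sum_distrib_right mult_ac
        flip: sum.cartesian_product) (subst sum.swap, simp add: mult_ac)
  also have "\<dots> \<le> K * B * X + Y"
  proof (intro add_mono mult_right_mono mult_left_mono)
    show "(\<Sum>\<alpha>\<in>\<Gamma>. \<theta> \<alpha>) \<le> B" by (rule \<theta>(3)[OF \<Gamma>(1)])
    show "(\<Sum>(\<alpha>, \<beta>)\<in>\<Gamma> \<times> \<Gamma>. \<theta> \<alpha> * \<theta> \<beta> * W \<alpha> \<beta>) \<le> Y"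
      unfolding Y_def using W \<theta>(1) \<Gamma>(1) by (intro finite_sum_le_infsum) auto
  qed (use X0 \<kappa> in auto)
  finally have "X \<le> \<kappa> * (K * B * X + Y)"
    using \<kappa>(1) by (simp add: mult_left_mono)
  also have "\<dots> = \<kappa> * (K * B) * X + \<kappa> * Y" by (simp add: algebra_simps)
  also have "\<dots> \<le> 1 / 2 * X + \<kappa> * Y"
    using \<kappa>(3) X0 by (intro add_right_mono mult_right_mono)
  finally have "X \<le> 2 * \<kappa> * Y" by simp
  moreover have "(\<Sum>\<gamma>\<in>A. \<theta> \<gamma> * d \<gamma>) \<le> X"
    unfolding X_def using \<Gamma>(1,2) \<theta>(1) d(1) by (intro sum_mono2) auto
  ultimately show ?thesis by (simp add: Y_def)
qed

text \<open>Tannery's theorem for unordered sums along a filter: outside a large finite set the dominating family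
  bounds the sum, and on it there are finitely many limits.\<close>

lemma infsum_dominated_convergence:
  fixes f :: "'i \<Rightarrow> 'x \<Rightarrow> real"
  assumes lim: "\<And>x. ((\<lambda>i. f i x) \<longlongrightarrow> 0) F"
    and dom: "\<forall>\<^sub>F i in F. \<forall>x. \<bar>f i x\<bar> \<le> g x" and g: "g summable_on UNIV"
  shows "((\<lambda>i. \<Sum>\<^sub>\<infinity>x. f i x) \<longlongrightarrow> 0) F"
  unfolding tendsto_iff
proof (intro allI impI)
  fix e :: real assume "e > 0"
  have fs: "f i summable_on UNIV" if "\<forall>x. \<bar>f i x\<bar> \<le> g x" for i
  proof -
    have "(\<lambda>x. norm (f i x)) summable_on UNIV"
      using g that by (intro Infinite_Sum.abs_summable_on_comparison_test'[of g]) auto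
    then show ?thesis by (rule abs_summable_summable)
  qed
  obtain J where J: "finite J" "dist (sum g J) (infsum g UNIV) < e / 2"
    using infsum_finite_approximation[OF g, of "e / 4"] \<open>e > 0\<close> by fastforce
  have "((\<lambda>i. \<Sum>x\<in>J. \<bar>f i x\<bar>) \<longlongrightarrow> (\<Sum>x\<in>J. \<bar>0\<bar>)) F"
    by (intro tendsto_intros lim)
  then have "\<forall>\<^sub>F i in F. (\<Sum>x\<in>J. \<bar>f i x\<bar>) < e / 2"
    using \<open>e > 0\<close> by (intro order_tendstoD(2)) auto
  then show "\<forall>\<^sub>F i in F. dist (\<Sum>\<^sub>\<infinity>x. f i x) 0 < e"
    using dom
  proof eventually_elim
    case (elim i)
    have f: "f i summable_on S" and gS: "g summable_on S" for S
      using fs[OF elim(2)] g summable_on_subset_banach by blast+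
    have "(\<Sum>\<^sub>\<infinity>x. f i x) = (\<Sum>x\<in>J. f i x) + (\<Sum>\<^sub>\<infinity>x\<in>-J. f i x)"
      using infsum_Un_disjoint[of "f i" J "- J"] f J(1) by simp
    moreover have "\<bar>\<Sum>x\<in>J. f i x\<bar> < e / 2"
      using sum_abs[of "f i" J] elim(1) by linarith
    moreover have "\<bar>\<Sum>\<^sub>\<infinity>x\<in>-J. f i x\<bar> \<le> (\<Sum>\<^sub>\<infinity>x\<in>-J. g x)"
      using infsum_mono[OF f gS, of "- J"] infsum_mono[OF summable_on_uminus[THEN iffD2, OF f] gS, of "- J"] elim(2)
      by (simp add: infsum_uminus abs_le_iff)
    moreover have "(\<Sum>\<^sub>\<infinity>x. g x) = (\<Sum>x\<in>J. g x) + (\<Sum>\<^sub>\<infinity>x\<in>-J. g x)"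
      using infsum_Un_disjoint[of g J "- J"] gS J(1) by simp
    ultimately show ?case using J(2) by (simp add: dist_real_def)
  qed
qed

section \<open>Kondratiev norms\<close>

lemma kondratiev_coefficient_growth:
  assumes "F \<in> kondratiev X nrm"
  obtains p C where "C \<ge> 0" "\<And>\<gamma>. nrm (F \<gamma>) \<le> C * two_N_pow (real p / 2) \<gamma>"
proof -
  obtain p where "kondratiev_norm nrm p F < \<infinity>"
    using assms by (auto simp: kondratiev_def)
  let ?t = "\<lambda>\<gamma>. (nrm (F \<gamma>))\<^sup>2 * two_N_pow (- real p) \<gamma>"
  have sm: "?t summable_on UNIV"
    using \<open>kondratiev_norm nrm p F < \<infinity>\<close> by (auto simp: kondratiev_norm_def split: if_splits)
  have nn: "?t \<gamma> \<ge> 0" for \<gamma> by (simp add: two_N_pow_nonneg)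
  have le: "?t \<gamma> \<le> infsum ?t UNIV" for \<gamma>
    using finite_sum_le_infsum[OF sm, of "{\<gamma>}"] nn by simp
  show thesis
  proof (rule that[of "sqrt (infsum ?t UNIV)" p])
    show "sqrt (infsum ?t UNIV) \<ge> 0" using le nn order_trans by (simp add: infsum_nonneg)
    fix \<gamma>
    have "(nrm (F \<gamma>))\<^sup>2 = ?t \<gamma> * two_N_pow (real p) \<gamma>"
    proof -
      have "two_N_pow (- real p) \<gamma> * two_N_pow (real p) \<gamma> = two_N_pow 0 \<gamma>"
        by (simp flip: two_N_pow_add_exponent)
      also have "two_N_pow 0 \<gamma> = 1"
        by (simp add: two_N_pow_def)
      finally have "two_N_pow (- real p) \<gamma> * two_N_pow (real p) \<gamma> = 1" .
      then show ?thesis by (simp add: mult.assoc)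
    qed
    also have "\<dots> \<le> infsum ?t UNIV * two_N_pow (real p) \<gamma>"
      using le by (intro mult_right_mono) (simp_all add: two_N_pow_nonneg)
    also have "two_N_pow (real p) \<gamma> = (two_N_pow (real p / 2) \<gamma>)\<^sup>2"
      unfolding power2_eq_square two_N_pow_add_exponent[symmetric] by simp
    finally have "nrm (F \<gamma>) \<le> sqrt (infsum ?t UNIV * (two_N_pow (real p / 2) \<gamma>)\<^sup>2)"
      by (rule real_le_rsqrt)
    also have "\<dots> = sqrt (infsum ?t UNIV) * two_N_pow (real p / 2) \<gamma>"
      by (simp add: real_sqrt_mult two_N_pow_nonneg)
    finally show "nrm (F \<gamma>) \<le> sqrt (infsum ?t UNIV) * two_N_pow (real p / 2) \<gamma>" .
  qed
qed

text \<open>The \<open>l\<^sup>2\<close> norm is at most the \<open>l\<^sup>1\<close> norm. The weight in the square of the Kondratiev norm is the square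
  of the weight that appears here.\<close>

lemma kondratiev_norm_le:
  assumes nn: "\<And>\<gamma>. nrm (F \<gamma>) \<ge> 0"
    and le: "\<And>A. finite A \<Longrightarrow> (\<Sum>\<gamma>\<in>A. two_N_pow (- real p / 2) \<gamma> * nrm (F \<gamma>)) \<le> B"
  shows "kondratiev_norm nrm p F \<le> ennreal B"
proof -
  define x where "x \<gamma> = two_N_pow (- real p / 2) \<gamma> * nrm (F \<gamma>)" for \<gamma>
  have x0: "x \<gamma> \<ge> 0" for \<gamma> using nn by (simp add: x_def two_N_pow_nonneg)
  have B: "B \<ge> 0" using le[of "{}"] by simp
  have "two_N_pow (- real p) \<gamma> = (two_N_pow (- real p / 2) \<gamma>)\<^sup>2" for \<gamma>
    unfolding power2_eq_square two_N_pow_add_exponent[symmetric] by simp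
  then have t: "(\<lambda>\<gamma>. (nrm (F \<gamma>))\<^sup>2 * two_N_pow (- real p) \<gamma>) = (\<lambda>\<gamma>. (x \<gamma>)\<^sup>2)"
    by (simp add: x_def power_mult_distrib mult.commute)
  have fin: "(\<Sum>\<gamma>\<in>A. (x \<gamma>)\<^sup>2) \<le> B\<^sup>2" if "finite A" for A
  proof -
    have "x \<gamma> \<le> B" for \<gamma> using le[of "{\<gamma>}"] by (simp add: x_def)
    then have "(\<Sum>\<gamma>\<in>A. (x \<gamma>)\<^sup>2) \<le> (\<Sum>\<gamma>\<in>A. B * x \<gamma>)"
      using x0 by (intro sum_mono) (simp add: power2_eq_square mult_right_mono)
    also have "\<dots> = B * (\<Sum>\<gamma>\<in>A. x \<gamma>)" by (simp add: sum_distrib_left)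
    also have "\<dots> \<le> B * B" using le[OF that] B by (intro mult_left_mono) (simp_all add: x_def)
    finally show ?thesis by (simp add: power2_eq_square)
  qed
  have sm: "(\<lambda>\<gamma>. (x \<gamma>)\<^sup>2) summable_on UNIV"
    using fin by (intro nonneg_bdd_above_summable_on) (auto simp: bdd_above_def)
  have "(\<Sum>\<^sub>\<infinity>\<gamma>. (x \<gamma>)\<^sup>2) \<le> B\<^sup>2"
    using fin by (intro infsum_le_finite_sums[OF sm]) auto
  then have "sqrt (\<Sum>\<^sub>\<infinity>\<gamma>. (x \<gamma>)\<^sup>2) \<le> B"
    using B real_sqrt_le_mono by fastforce
  then show ?thesis
    by (simp add: kondratiev_norm_def t sm ennreal_leI)
qed

section \<open>Functions of time\<close>

text \<open>The bound holds for Riemann sums of both functions over one partition that is fine for both, and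
  passes to the limit.\<close>

lemma has_integral_norm_le:
  fixes f :: "real \<Rightarrow> 'x::real_normed_vector" and g :: "real \<Rightarrow> real"
  assumes f: "(f has_integral y) {a..b}" and g: "(g has_integral c) {a..b}"
    and le: "\<And>x. x \<in> {a..b} \<Longrightarrow> norm (f x) \<le> g x"
  shows "norm y \<le> c"
proof (rule field_le_epsilon)
  fix e :: real assume "e > 0"
  then have e: "e / 2 > 0" by simp
  obtain \<gamma>\<^sub>1 where 1: "gauge \<gamma>\<^sub>1" "\<And>p. p tagged_division_of cbox a b \<Longrightarrow> \<gamma>\<^sub>1 fine p \<Longrightarrow>
      norm ((\<Sum>(x, k)\<in>p. measure lborel k *\<^sub>R f x) - y) < e / 2"
    using has_integralD[OF f[unfolded box_real[symmetric]] e] by blast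
  obtain \<gamma>\<^sub>2 where 2: "gauge \<gamma>\<^sub>2" "\<And>p. p tagged_division_of cbox a b \<Longrightarrow> \<gamma>\<^sub>2 fine p \<Longrightarrow>
      norm ((\<Sum>(x, k)\<in>p. measure lborel k *\<^sub>R g x) - c) < e / 2"
    using has_integralD[OF g[unfolded box_real[symmetric]] e] by blast
  obtain p where p: "p tagged_division_of cbox a b" "\<gamma>\<^sub>1 fine p" "\<gamma>\<^sub>2 fine p"
    using fine_division_exists[OF gauge_Int[OF 1(1) 2(1)], of a b] fine_Int by metis
  have "norm (\<Sum>(x, k)\<in>p. measure lborel k *\<^sub>R f x) \<le> (\<Sum>(x, k)\<in>p. measure lborel k *\<^sub>R g x)"
  proof (rule order_trans[OF norm_sum sum_mono], clarify)
    fix x k assume "(x, k) \<in> p"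
    then have "x \<in> {a..b}"
      using tagged_division_ofD(2,3)[OF p(1)] by (metis box_real(2) subsetD)
    then show "norm (measure lborel k *\<^sub>R f x) \<le> measure lborel k *\<^sub>R g x"
      using le by (simp add: mult_left_mono)
  qed
  moreover have "norm y \<le> norm (\<Sum>(x, k)\<in>p. measure lborel k *\<^sub>R f x)
      + norm ((\<Sum>(x, k)\<in>p. measure lborel k *\<^sub>R f x) - y)"
    using norm_triangle_ineq4[of "\<Sum>(x, k)\<in>p. measure lborel k *\<^sub>R f x" "(\<Sum>(x, k)\<in>p. measure lborel k *\<^sub>R f x) - y"]
    by simp
  ultimately show "norm y \<le> c + e"
    using 1(2)[OF p(1,2)] 2(2)[OF p(1,3)] unfolding real_norm_def by linarith
qed

text \<open>Equicontinuity and pointwise convergence give uniform convergence on compact sets, by means of a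
  finite net.\<close>

lemma uniform_on_compact_of_equi_Lipschitz:
  fixes B :: "'i \<Rightarrow> 'x::real_normed_vector \<Rightarrow> 'y::real_normed_vector"
  assumes "compact C" and lip: "\<forall>\<^sub>F i in F. \<forall>u v. norm (B i u - B i v) \<le> c * norm (u - v)"
    and lim: "\<And>u. ((\<lambda>i. B i u) \<longlongrightarrow> 0) F" and "e > 0"
  shows "\<forall>\<^sub>F i in F. \<forall>u\<in>C. norm (B i u) \<le> e"
proof -
  define r where "r = e / (2 * (\<bar>c\<bar> + 1))"
  have "r > 0" using \<open>e > 0\<close> by (simp add: r_def)
  obtain N where N: "finite N" "C \<subseteq> (\<Union>v\<in>N. ball v r)"
    using seq_compact_imp_totally_bounded[of C] \<open>compact C\<close> \<open>r > 0\<close>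
    by (auto simp: compact_eq_seq_compact_metric)
  have "\<forall>\<^sub>F i in F. norm (B i v) < e / 2" for v
    using tendsto_norm[OF lim[of v]] \<open>e > 0\<close> by (intro order_tendstoD(2)) auto
  then have "\<forall>\<^sub>F i in F. \<forall>v\<in>N. norm (B i v) < e / 2"
    using N(1) by (simp add: eventually_ball_finite)
  with lip show ?thesis
  proof eventually_elim
    case (elim i)
    show ?case
    proof
      fix u assume "u \<in> C"
      then obtain v where v: "v \<in> N" "norm (u - v) < r"
        using N(2) by (auto simp: dist_norm norm_minus_commute)
      have "norm (B i u) \<le> norm (B i v) + norm (B i u - B i v)"
        using norm_triangle_ineq[of "B i v" "B i u - B i v"] by simp
      also have "norm (B i u - B i v) \<le> c * norm (u - v)" using elim(1) by blast
      also have "\<dots> \<le> (\<bar>c\<bar> + 1) * r" using v(2) by (intro mult_mono) auto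
      also have "\<dots> = e / 2" by (simp add: r_def field_simps)
      finally show "norm (B i u) \<le> e" using elim(2) v(1) by fastforce
    qed
  qed
qed

text \<open>This is the instance of absolute continuity for families of a single interval.\<close>

lemma AC_continuous_on:
  assumes "f \<in> AC T X"
  shows "continuous_on {0..T} f"
  unfolding continuous_on_iff
proof (intro ballI allI impI)
  fix x e :: real assume x: "x \<in> {0..T}" and "e > 0"
  then obtain \<delta> where \<delta>: "\<delta> > 0" and *: "\<And>n (a :: nat \<Rightarrow> real) b.
      (\<forall>i<n. 0 \<le> a i \<and> a i \<le> b i \<and> b i \<le> T) \<and> disjoint_family_on (\<lambda>i. {a i<..<b i}) {..<n} \<and>
        (\<Sum>i<n. b i - a i) < \<delta> \<Longrightarrow> (\<Sum>i<n. norm (f (b i) - f (a i))) < e"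
    using assms unfolding AC_def by blast
  have "dist (f y) (f x) < e" if "y \<in> {0..T}" "dist y x < \<delta>" for y
  proof -
    have "norm (f (max x y) - f (min x y)) < e"
      using *[of 1 "\<lambda>_. min x y" "\<lambda>_. max x y"] that x
      by (auto simp: disjoint_family_on_def dist_real_def abs_if min_def max_def split: if_splits)
    then show ?thesis
      by (auto simp: dist_norm norm_minus_commute max_def min_def split: if_splits)
  qed
  with \<delta> show "\<exists>d>0. \<forall>y\<in>{0..T}. dist y x < d \<longrightarrow> dist (f y) (f x) < e" by blast
qed

lemma norm_le_sup_norm:
  assumes "continuous_on {0..T} f" "t \<in> {0..T}"
  shows "norm (f t) \<le> sup_norm T f"
proof -
  have "compact ((\<lambda>t. norm (f t)) ` {0..T})"
    using assms by (intro compact_continuous_image continuous_intros) auto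
  then show ?thesis
    unfolding sup_norm_def using assms(2)
    by (intro cSUP_upper) (auto intro: bounded_imp_bdd_above compact_imp_bounded)
qed

lemma sup_norm_le:
  assumes "T \<ge> 0" "\<And>t. t \<in> {0..T} \<Longrightarrow> norm (f t) \<le> c"
  shows "sup_norm T f \<le> c"
  unfolding sup_norm_def using assms by (intro cSUP_least) auto

lemma sup_norm_nonneg:
  assumes "continuous_on {0..T} f" "T \<ge> 0"
  shows "sup_norm T f \<ge> 0"
  using norm_le_sup_norm[OF assms(1), of 0] assms(2) by (auto intro: order_trans[OF norm_ge_zero])

section \<open>Stability under a change of the potential\<close>

text \<open>The size of the source term that a change of the potential from \<open>q\<close> to \<open>r\<close> produces in the
  equation for the difference of two solutions.\<close>

definition potential_defect ::
  "real \<Rightarrow> ('a::euclidean_space \<Rightarrow> 'b::{real_normed_field,banach,second_countable_topology})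
     \<Rightarrow> ('a \<Rightarrow> 'b) \<Rightarrow> (real \<Rightarrow> ('a, 'b) L2) \<Rightarrow> real" where
  "potential_defect T r q v = sup_norm T (\<lambda>t. Linf_mult r (v t) - Linf_mult q (v t))"

text \<open>The difference of two solutions with the same data solves a Volterra equation whose integrand is, up
  to the sign and the action of the semigroup,
  \<open>R \<alpha> (U \<beta> - V \<beta>) + (R \<alpha> - Q \<alpha>) V \<beta>\<close>, summed over \<open>\<alpha> + \<beta> = \<gamma>\<close>. In the norm weighted with
  \<open>exp (- \<rho> t)\<close> (Bielecki's norm) the integration in time gains the factor \<open>1 / \<rho>\<close>; this replaces
  Gronwall's inequality and later provides the small constant for the absorption.\<close>

lemma weighted_coefficient_difference:
  fixes R Q :: "('a::euclidean_space \<Rightarrow> 'b::{real_normed_field,banach,second_countable_topology}) gsp"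
    and U V :: "(real \<Rightarrow> ('a, 'b) L2) gsp"
  assumes T: "T > 0" and \<rho>: "\<rho> > 0" and M: "M \<ge> 0" "\<And>t. t \<in> {0..T} \<Longrightarrow> norm (S t) \<le> M"
    and R: "\<And>\<alpha>. R \<alpha> \<in> Linf" "\<And>\<alpha>. AE x in lborel. norm (R \<alpha> x) \<le> K" "K \<ge> 0"
    and Q: "\<And>\<alpha>. Q \<alpha> \<in> Linf"
    and cont: "\<And>\<gamma>. continuous_on {0..T} (U \<gamma>)" "\<And>\<gamma>. continuous_on {0..T} (V \<gamma>)"
    and weak: "\<And>\<gamma>. weak_solution T S (R 0) (propagator_force R F U \<gamma>) (G \<gamma>) (U \<gamma>)"
      "\<And>\<gamma>. weak_solution T S (Q 0) (propagator_force Q F V \<gamma>) (G \<gamma>) (V \<gamma>)"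
  defines "d \<equiv> \<lambda>\<gamma>. sup_norm T (\<lambda>t. exp (- \<rho> * t) *\<^sub>R (U \<gamma> t - V \<gamma> t))"
  shows "d \<gamma> \<le> M / \<rho> * (\<Sum>(\<alpha>, \<beta>)\<in>{(\<alpha>, \<beta>). \<alpha> + \<beta> = \<gamma>}. K * d \<beta> + potential_defect T (R \<alpha>) (Q \<alpha>) (V \<beta>))"
    (is "_ \<le> M / \<rho> * ?X")
proof -
  have norm_d: "norm (U \<beta> s - V \<beta> s) \<le> exp (\<rho> * s) * d \<beta>" if "s \<in> {0..T}" for \<beta> s
  proof -
    have "continuous_on {0..T} (\<lambda>t. exp (- \<rho> * t) *\<^sub>R (U \<beta> t - V \<beta> t))"
      by (intro continuous_intros cont)
    from norm_le_sup_norm[OF this that]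
    have "exp (- \<rho> * s) * norm (U \<beta> s - V \<beta> s) \<le> d \<beta>" by (simp add: d_def)
    then show ?thesis by (simp add: exp_minus field_simps)
  qed
  have defect: "norm (Linf_mult (R \<alpha>) (V \<beta> s) - Linf_mult (Q \<alpha>) (V \<beta> s))
      \<le> potential_defect T (R \<alpha>) (Q \<alpha>) (V \<beta>)" if "s \<in> {0..T}" for \<alpha> \<beta> s
    unfolding potential_defect_def
    by (rule norm_le_sup_norm[OF _ that]) (intro continuous_intros continuous_on_Linf_mult R Q cont)
  have defect0: "potential_defect T (R \<alpha>) (Q \<alpha>) (V \<beta>) \<ge> 0" for \<alpha> \<beta>
    using defect[of 0 \<alpha> \<beta>] T order_trans[OF norm_ge_zero] by auto
  have d0: "d \<beta> \<ge> 0" for \<beta>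
    using norm_d[of 0 \<beta>] T order_trans[OF norm_ge_zero] by auto
  have X0: "?X \<ge> 0"
    using defect0 d0 R(3) by (intro sum_nonneg) auto
  have d_eq: "d \<gamma> = sup_norm T (\<lambda>t. exp (- \<rho> * t) *\<^sub>R (U \<gamma> t - V \<gamma> t))"
    by (simp add: d_def)
  show ?thesis
    unfolding d_eq
  proof (rule sup_norm_le)
    fix t assume t: "t \<in> {0..T}"
    define z where "z s = wick Linf_mult Q (\<lambda>\<beta>. V \<beta> s) \<gamma> - wick Linf_mult R (\<lambda>\<beta>. U \<beta> s) \<gamma>" for s
    have "((\<lambda>s. S (t - s) (F \<gamma> s - wick Linf_mult R (\<lambda>\<beta>. U \<beta> s) \<gamma>)
            - S (t - s) (F \<gamma> s - wick Linf_mult Q (\<lambda>\<beta>. V \<beta> s) \<gamma>))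
         has_integral ((U \<gamma> t - S t (G \<gamma>)) - (V \<gamma> t - S t (G \<gamma>)))) {0..t}"
      using weak[of \<gamma>] t unfolding weak_solution_def propagator_force_wick
      by (intro has_integral_diff) auto
    then have int: "((\<lambda>s. S (t - s) (z s)) has_integral (U \<gamma> t - V \<gamma> t)) {0..t}"
      by (simp add: z_def flip: blinfun.diff_right)
    have "((\<lambda>s. M * ?X * exp (\<rho> * s)) has_integral M * ?X / \<rho> * exp (\<rho> * t) - M * ?X / \<rho> * exp (\<rho> * 0)) {0..t}"
      using t \<rho>
      by (intro fundamental_theorem_of_calculus)
        (auto intro!: derivative_eq_intros simp flip: has_real_derivative_iff_has_vector_derivative)
    from int this have "norm (U \<gamma> t - V \<gamma> t) \<le> M * ?X / \<rho> * exp (\<rho> * t) - M * ?X / \<rho> * exp (\<rho> * 0)"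
    proof (rule has_integral_norm_le)
      fix s assume "s \<in> {0..t}"
      then have s: "s \<in> {0..T}" "t - s \<in> {0..T}" using t by auto
      have z_eq: "z s = (\<Sum>(\<alpha>, \<beta>)\<in>{(\<alpha>, \<beta>). \<alpha> + \<beta> = \<gamma>}. Linf_mult (Q \<alpha>) (V \<beta> s) - Linf_mult (R \<alpha>) (U \<beta> s))"
        unfolding z_def wick_def by (simp add: case_prod_unfold sum_subtractf)
      have "norm (z s) \<le> (\<Sum>(\<alpha>, \<beta>)\<in>{(\<alpha>, \<beta>). \<alpha> + \<beta> = \<gamma>}.
          exp (\<rho> * s) * (K * d \<beta> + potential_defect T (R \<alpha>) (Q \<alpha>) (V \<beta>)))"
        unfolding z_eq
      proof (rule order_trans[OF norm_sum sum_mono], clarify)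
        fix \<alpha> \<beta> :: multiindex
        have "norm (Linf_mult (Q \<alpha>) (V \<beta> s) - Linf_mult (R \<alpha>) (U \<beta> s))
            = norm (Linf_mult (R \<alpha>) (U \<beta> s - V \<beta> s) + (Linf_mult (R \<alpha>) (V \<beta> s) - Linf_mult (Q \<alpha>) (V \<beta> s)))"
          by (simp add: Linf_mult_diff_right[OF R(1)] norm_minus_commute)
        also have "\<dots> \<le> norm (Linf_mult (R \<alpha>) (U \<beta> s - V \<beta> s))
            + norm (Linf_mult (R \<alpha>) (V \<beta> s) - Linf_mult (Q \<alpha>) (V \<beta> s))"
          by (rule norm_triangle_ineq)
        also have "norm (Linf_mult (R \<alpha>) (U \<beta> s - V \<beta> s)) \<le> K * (exp (\<rho> * s) * d \<beta>)"
          using norm_Linf_mult_le[OF R] norm_d[OF s(1)] R(3)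
          by (meson mult_left_mono order_trans)
        also have "norm (Linf_mult (R \<alpha>) (V \<beta> s) - Linf_mult (Q \<alpha>) (V \<beta> s))
            \<le> exp (\<rho> * s) * potential_defect T (R \<alpha>) (Q \<alpha>) (V \<beta>)"
          using defect[OF s(1), of \<alpha> \<beta>] mult_right_mono[OF one_le_exp_iff[THEN iffD2, of "\<rho> * s"] defect0[of \<alpha> \<beta>]] s \<rho>
          by simp
        finally show "norm (Linf_mult (Q \<alpha>) (V \<beta> s) - Linf_mult (R \<alpha>) (U \<beta> s))
            \<le> exp (\<rho> * s) * (K * d \<beta> + potential_defect T (R \<alpha>) (Q \<alpha>) (V \<beta>))"
          by (simp add: algebra_simps)
      qed
      also have "\<dots> = exp (\<rho> * s) * ?X"
        by (simp add: sum_distrib_left case_prod_unfold)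
      finally have z: "norm (z s) \<le> exp (\<rho> * s) * ?X" .
      have "norm (S (t - s) (z s)) \<le> norm (S (t - s)) * norm (z s)" by (rule norm_blinfun)
      also have "\<dots> \<le> M * (exp (\<rho> * s) * ?X)"
        using M s z by (intro mult_mono) auto
      finally show "norm (S (t - s) (z s)) \<le> M * ?X * exp (\<rho> * s)" by (simp add: mult_ac)
    qed
    also have "\<dots> \<le> M / \<rho> * ?X * exp (\<rho> * t)"
      using M X0 \<rho> by simp
    finally have "exp (- \<rho> * t) * norm (U \<gamma> t - V \<gamma> t)
        \<le> exp (- \<rho> * t) * (M / \<rho> * ?X * exp (\<rho> * t))"
      by (rule mult_left_mono) simp
    also have "\<dots> = M / \<rho> * ?X" by (simp add: exp_minus)
    finally show "norm (exp (- \<rho> * t) *\<^sub>R (U \<gamma> t - V \<gamma> t)) \<le> M / \<rho> * ?X"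
      by simp
  qed (use T in simp)
qed

section \<open>Convergence of the regularized solutions\<close>

theorem theorem5p1:
  fixes T M w :: real
    and S :: "real \<Rightarrow> (real ^ 'd, 'k::{real_normed_field,banach,second_countable_topology}) L2
                \<Rightarrow>\<^sub>L (real ^ 'd, 'k) L2"
    and D :: "(real ^ 'd, 'k) L2 set"
    and L :: "(real ^ 'd, 'k) L2 \<Rightarrow> (real ^ 'd, 'k) L2"
    and Q :: "(real ^ 'd \<Rightarrow> 'k) gsp"
    and F V :: "(real \<Rightarrow> (real ^ 'd, 'k) L2) gsp"
    and G :: "(real ^ 'd, 'k) L2 gsp"
    and \<phi> :: "real ^ 'd \<Rightarrow> real"
    and \<Lambda> :: "real \<Rightarrow> real"
    and U :: "real \<Rightarrow> (real \<Rightarrow> (real ^ 'd, 'k) L2) gsp"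
  assumes T: "T > 0"
    and operator: "closed_operator D L" "closure D = UNIV"
      "C0_semigroup S" "is_generator D L S"
      "M > 0" "\<And>t. t \<ge> 0 \<Longrightarrow> norm (S t) \<le> M * exp (w * t)"
    and potential: "Q \<in> kondratiev Linf Linf_norm"
      "bdd_above (range (\<lambda>\<gamma>. Linf_norm (Q \<gamma>)))" "0 < (SUP \<gamma>. Linf_norm (Q \<gamma>))"
    and force: "F \<in> kondratiev (AC T UNIV) (sup_norm T)"
    and initial: "G \<in> kondratiev D norm"
    and mollification: "mollifier \<phi>" "\<And>\<epsilon>. \<epsilon> \<in> {0<..1} \<Longrightarrow> \<Lambda> \<epsilon> > 0" "(\<Lambda> \<longlongrightarrow> 0) (at_right 0)"
    and V: "stochastic_weak_solution T S D Q F G V"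
    and U: "stochastic_very_weak_solution T S D
              (\<lambda>\<epsilon>. regularize Q (mollifying_net \<phi> \<Lambda> \<epsilon>)) F G U"
  shows "\<exists>p>1. ((\<lambda>\<epsilon>. kondratiev_norm (sup_norm T) p (\<lambda>\<gamma> t. U \<epsilon> \<gamma> t - V \<gamma> t)) \<longlongrightarrow> 0) (at_right 0)"
proof -
  define K where "K = (SUP \<gamma>. Linf_norm (Q \<gamma>))"
  have K: "K > 0" using potential(3) by (simp add: K_def)
  have Q: "Q \<alpha> \<in> Linf" for \<alpha> using potential(1) by (simp add: kondratiev_def)
  then have Q_meas[measurable]: "Q \<alpha> \<in> borel_measurable borel" for \<alpha> by (simp add: Linf_def)
  have QK: "AE x in lborel. norm (Q \<alpha> x) \<le> K" for \<alpha>
  proof -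
    have "Linf_norm (Q \<alpha>) \<le> K" unfolding K_def by (rule cSUP_upper[OF _ potential(2)]) simp
    with AE_norm_le_Linf_norm[OF Q[of \<alpha>]] show ?thesis by (auto elim: eventually_mono)
  qed
  define R where "R \<epsilon> = regularize Q (mollifying_net \<phi> \<Lambda> \<epsilon>)" for \<epsilon>
  have R_eq: "R \<epsilon> \<alpha> = mollified (Q \<alpha>) \<phi> (\<Lambda> \<epsilon>)" for \<epsilon> \<alpha>
    by (simp add: R_def regularize_def mollifying_net_def[abs_def])
  have R_le: "norm (R \<epsilon> \<alpha> x) \<le> K" if "\<epsilon> \<in> {0<..1}" for \<epsilon> \<alpha> x
    unfolding R_eq using mollified_integrand(2)[OF mollification(1) _ QK] mollification(2)[OF that] by simp
  have R: "R \<epsilon> \<alpha> \<in> Linf" if "\<epsilon> \<in> {0<..1}" for \<epsilon> \<alpha>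
    using R_le[OF that] mollified_measurable[OF mollification(1) Q_meas]
    by (intro LinfI[where K = K]) (auto simp: R_eq)
  have V_weak: "\<And>\<gamma>. weak_solution T S (Q 0) (propagator_force Q F V \<gamma>) (G \<gamma>) (V \<gamma>)"
    and V_kond: "V \<in> kondratiev (AC T D) (sup_norm T)"
    using V by (auto simp: stochastic_weak_solution_def)
  have V_cont: "continuous_on {0..T} (V \<gamma>)" for \<gamma>
    using V_kond AC_continuous_on by (auto simp: kondratiev_def)
  have U_weak: "weak_solution T S (R \<epsilon> 0) (propagator_force (R \<epsilon>) F (U \<epsilon>) \<gamma>) (G \<gamma>) (U \<epsilon> \<gamma>)"
    and U_AC: "U \<epsilon> \<gamma> \<in> AC T D" if "\<epsilon> \<in> {0<..1}" for \<epsilon> \<gamma>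
    using U that
    by (auto simp: R_def stochastic_very_weak_solution_def stochastic_weak_solution_def kondratiev_def)

  have U_cont: "continuous_on {0..T} (U \<epsilon> \<gamma>)" if "\<epsilon> \<in> {0<..1}" for \<epsilon> \<gamma>
    by (rule AC_continuous_on[OF U_AC[OF that]])

  obtain p0 C where C: "C \<ge> 0" "\<And>\<gamma>. sup_norm T (V \<gamma>) \<le> C * two_N_pow (real p0 / 2) \<gamma>"
    using kondratiev_coefficient_growth[OF V_kond] by blast
  \<comment> \<open>The weight of exponent \<open>- p / 2\<close> still has exponent at most \<open>- 2\<close> after it has absorbed the growth of
    the coefficients of \<open>V\<close>; for such exponents the sum of the weights is at most \<open>2\<close>.\<close>
  define p where "p = p0 + 4"
  define \<theta> where "\<theta> = two_N_pow (- real p / 2)"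
  have \<theta>_exp: "- real p / 2 \<le> - 2" by (simp add: p_def)
  have \<theta>0: "\<theta> \<gamma> \<ge> 0" for \<gamma> by (simp add: \<theta>_def two_N_pow_nonneg)

  define M' where "M' = M * exp (\<bar>w\<bar> * T)"
  have M': "M' > 0" using operator(5) by (simp add: M'_def)
  have S_le: "norm (S t) \<le> M'" if "t \<in> {0..T}" for t
  proof -
    have "w * t \<le> \<bar>w\<bar> * T" using that by (intro mult_mono) auto
    then have "M * exp (w * t) \<le> M'" using operator(5) by (simp add: M'_def)
    with operator(6)[of t] that show ?thesis by simp
  qed
  \<comment> \<open>The rate is chosen such that the gain \<open>M' / \<rho>\<close> compensates the norm \<open>K\<close> of the potential
    coefficients times the bound \<open>2\<close> on the sum of the weights.\<close>
  define \<rho> where "\<rho> = 4 * M' * K"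
  have \<rho>: "\<rho> > 0" using M' K by (simp add: \<rho>_def)
  have absorb: "M' / \<rho> * (K * 2) \<le> 1 / 2" using M' K by (simp add: \<rho>_def)

  define W where "W \<epsilon> \<alpha> \<beta> = potential_defect T (R \<epsilon> \<alpha>) (Q \<alpha>) (V \<beta>)" for \<epsilon> \<alpha> \<beta>
  have W_cont: "continuous_on {0..T} (\<lambda>t. Linf_mult (R \<epsilon> \<alpha>) (V \<beta> t) - Linf_mult (Q \<alpha>) (V \<beta> t))"
    if "\<epsilon> \<in> {0<..1}" for \<epsilon> \<alpha> \<beta>
    by (intro continuous_intros continuous_on_Linf_mult R Q V_cont that)
  have W0: "W \<epsilon> \<alpha> \<beta> \<ge> 0" if "\<epsilon> \<in> {0<..1}" for \<epsilon> \<alpha> \<beta>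
    unfolding W_def potential_defect_def using sup_norm_nonneg[OF W_cont[OF that]] T by simp
  have unit: "\<forall>\<^sub>F \<epsilon> in at_right 0. \<epsilon> \<in> {0<..1::real}"
    unfolding eventually_at_right_field by (rule exI[of _ 1]) auto
  define g where "g = (\<lambda>(\<alpha>, \<beta>). 2 * K * C * (two_N_pow (- real p / 2) \<alpha> * two_N_pow (- 2) \<beta>))"
  have g: "g summable_on UNIV"
    using summable_on_cmult_right[OF summable_two_N_pow_product[OF \<theta>_exp order_refl], of "2 * K * C"]
    by (simp add: g_def case_prod_unfold)
  have dominated: "\<theta> \<alpha> * \<theta> \<beta> * W \<epsilon> \<alpha> \<beta> \<le> g (\<alpha>, \<beta>)" if \<epsilon>: "\<epsilon> \<in> {0<..1}" for \<epsilon> \<alpha> \<beta>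
  proof -
    have "W \<epsilon> \<alpha> \<beta> \<le> 2 * K * (C * two_N_pow (real p0 / 2) \<beta>)"
      unfolding W_def potential_defect_def
    proof (rule sup_norm_le)
      fix t assume t: "t \<in> {0..T}"
      have "norm (Linf_mult (R \<epsilon> \<alpha>) (V \<beta> t) - Linf_mult (Q \<alpha>) (V \<beta> t))
          \<le> norm (Linf_mult (R \<epsilon> \<alpha>) (V \<beta> t)) + norm (Linf_mult (Q \<alpha>) (V \<beta> t))"
        by (rule norm_triangle_ineq4)
      also have "\<dots> \<le> K * norm (V \<beta> t) + K * norm (V \<beta> t)"
        using K R_le[OF \<epsilon>] QK by (intro add_mono norm_Linf_mult_le R[OF \<epsilon>] Q) auto
      also have "\<dots> = 2 * K * norm (V \<beta> t)" by simp
      also have "\<dots> \<le> 2 * K * (C * two_N_pow (real p0 / 2) \<beta>)"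
        using K order_trans[OF norm_le_sup_norm[OF V_cont t] C(2)] by (intro mult_left_mono) auto
      finally show "norm (Linf_mult (R \<epsilon> \<alpha>) (V \<beta> t) - Linf_mult (Q \<alpha>) (V \<beta> t))
          \<le> 2 * K * (C * two_N_pow (real p0 / 2) \<beta>)" .
    qed (use T in simp)
    then have "\<theta> \<alpha> * \<theta> \<beta> * W \<epsilon> \<alpha> \<beta> \<le> \<theta> \<alpha> * \<theta> \<beta> * (2 * K * (C * two_N_pow (real p0 / 2) \<beta>))"
      using \<theta>0 by (intro mult_left_mono) auto
    also have "\<dots> = 2 * K * C * (\<theta> \<alpha> * (\<theta> \<beta> * two_N_pow (real p0 / 2) \<beta>))"
      by (simp add: mult_ac)
    also have "\<theta> \<beta> * two_N_pow (real p0 / 2) \<beta> = two_N_pow (- 2) \<beta>"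
      unfolding \<theta>_def two_N_pow_add_exponent[symmetric] by (simp add: p_def field_simps)
    finally show ?thesis by (simp add: g_def \<theta>_def)
  qed
  have W_lim: "((\<lambda>\<epsilon>. W \<epsilon> \<alpha> \<beta>) \<longlongrightarrow> 0) (at_right 0)" for \<alpha> \<beta>
  proof -
    have "\<forall>\<^sub>F \<epsilon> in at_right 0. \<Lambda> \<epsilon> \<in> {0<..} \<and> \<Lambda> \<epsilon> \<noteq> 0"
      using unit by eventually_elim (use mollification(2) in force)
    then have "filterlim \<Lambda> (at_right 0) (at_right 0)"
      using mollification(3) by (simp add: filterlim_at)
    then have strong: "((\<lambda>\<epsilon>. Linf_mult (R \<epsilon> \<alpha>) u - Linf_mult (Q \<alpha>) u) \<longlongrightarrow> 0) (at_right 0)" for u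
      using filterlim_compose[OF Linf_mult_mollified_tendsto[OF mollification(1) Q]]
      by (simp add: R_eq LIM_zero_iff)
    have lip: "\<forall>\<^sub>F \<epsilon> in at_right 0. \<forall>u v. norm ((Linf_mult (R \<epsilon> \<alpha>) u - Linf_mult (Q \<alpha>) u)
        - (Linf_mult (R \<epsilon> \<alpha>) v - Linf_mult (Q \<alpha>) v)) \<le> 2 * K * norm (u - v)"
      using unit
    proof eventually_elim
      case (elim \<epsilon>)
      show ?case
      proof (intro allI)
        fix u v
        have "(Linf_mult (R \<epsilon> \<alpha>) u - Linf_mult (Q \<alpha>) u) - (Linf_mult (R \<epsilon> \<alpha>) v - Linf_mult (Q \<alpha>) v)
            = Linf_mult (R \<epsilon> \<alpha>) (u - v) - Linf_mult (Q \<alpha>) (u - v)"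
          by (simp add: Linf_mult_diff_right R[OF elim] Q)
        also have "norm \<dots> \<le> norm (Linf_mult (R \<epsilon> \<alpha>) (u - v)) + norm (Linf_mult (Q \<alpha>) (u - v))"
          by (rule norm_triangle_ineq4)
        also have "\<dots> \<le> K * norm (u - v) + K * norm (u - v)"
          using K R_le[OF elim] QK by (intro add_mono norm_Linf_mult_le R[OF elim] Q) auto
        finally show "norm ((Linf_mult (R \<epsilon> \<alpha>) u - Linf_mult (Q \<alpha>) u)
            - (Linf_mult (R \<epsilon> \<alpha>) v - Linf_mult (Q \<alpha>) v)) \<le> 2 * K * norm (u - v)" by simp
      qed
    qed
    \<comment> \<open>Strong convergence becomes uniform in time because the trajectory of \<open>V \<beta>\<close> is compact.\<close>
    have comp: "compact (V \<beta> ` {0..T})"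
      by (intro compact_continuous_image V_cont) simp
    show ?thesis
      unfolding tendsto_iff
    proof (intro allI impI)
      fix e :: real assume "e > 0"
      then have "\<forall>\<^sub>F \<epsilon> in at_right 0. \<forall>u\<in>V \<beta> ` {0..T}. norm (Linf_mult (R \<epsilon> \<alpha>) u - Linf_mult (Q \<alpha>) u) \<le> e / 2"
        by (intro uniform_on_compact_of_equi_Lipschitz[OF comp lip strong]) simp
      with unit show "\<forall>\<^sub>F \<epsilon> in at_right 0. dist (W \<epsilon> \<alpha> \<beta>) 0 < e"
      proof eventually_elim
        case (elim \<epsilon>)
        then have "W \<epsilon> \<alpha> \<beta> \<le> e / 2"
          unfolding W_def potential_defect_def using T by (intro sup_norm_le) auto
        with W0[OF elim(1), of \<alpha> \<beta>] \<open>e > 0\<close> show ?case by simp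
      qed
    qed
  qed
  define I where "I \<epsilon> = (\<Sum>\<^sub>\<infinity>(\<alpha>, \<beta>). \<theta> \<alpha> * \<theta> \<beta> * W \<epsilon> \<alpha> \<beta>)" for \<epsilon>
  have I: "(I \<longlongrightarrow> 0) (at_right 0)"
    unfolding I_def
  proof (rule infsum_dominated_convergence[OF _ _ g])
    show "((\<lambda>\<epsilon>. case x of (\<alpha>, \<beta>) \<Rightarrow> \<theta> \<alpha> * \<theta> \<beta> * W \<epsilon> \<alpha> \<beta>) \<longlongrightarrow> 0) (at_right 0)" for x
      using tendsto_mult_right_zero[OF W_lim] by (simp add: case_prod_unfold)
    show "\<forall>\<^sub>F \<epsilon> in at_right 0. \<forall>x. \<bar>case x of (\<alpha>, \<beta>) \<Rightarrow> \<theta> \<alpha> * \<theta> \<beta> * W \<epsilon> \<alpha> \<beta>\<bar> \<le> g x"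
      using unit by eventually_elim (use dominated \<theta>0 W0 in \<open>auto simp: abs_mult\<close>)
  qed
  have bound: "kondratiev_norm (sup_norm T) p (\<lambda>\<gamma> t. U \<epsilon> \<gamma> t - V \<gamma> t)
      \<le> ennreal (exp (\<rho> * T) * (2 * (M' / \<rho>) * I \<epsilon>))" if \<epsilon>: "\<epsilon> \<in> {0<..1}" for \<epsilon>
  proof (rule kondratiev_norm_le)
    define d where "d \<gamma> = sup_norm T (\<lambda>t. exp (- \<rho> * t) *\<^sub>R (U \<epsilon> \<gamma> t - V \<gamma> t))" for \<gamma>
    have d_cont: "continuous_on {0..T} (\<lambda>t. exp (- \<rho> * t) *\<^sub>R (U \<epsilon> \<gamma> t - V \<gamma> t))" for \<gamma>
      by (intro continuous_intros U_cont[OF \<epsilon>] V_cont)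
    have d0: "d \<gamma> \<ge> 0" for \<gamma> unfolding d_def using sup_norm_nonneg[OF d_cont] T by simp
    show "sup_norm T (\<lambda>t. U \<epsilon> \<gamma> t - V \<gamma> t) \<ge> 0" for \<gamma>
      using T by (intro sup_norm_nonneg continuous_intros U_cont[OF \<epsilon>] V_cont) simp
    have U_le_d: "sup_norm T (\<lambda>t. U \<epsilon> \<gamma> t - V \<gamma> t) \<le> exp (\<rho> * T) * d \<gamma>" for \<gamma>
    proof (rule sup_norm_le)
      fix t assume t: "t \<in> {0..T}"
      have "norm (U \<epsilon> \<gamma> t - V \<gamma> t) = exp (\<rho> * t) * norm (exp (- \<rho> * t) *\<^sub>R (U \<epsilon> \<gamma> t - V \<gamma> t))"
        by (simp flip: exp_add mult.assoc)
      also have "\<dots> \<le> exp (\<rho> * T) * d \<gamma>"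
        using t \<rho> norm_le_sup_norm[OF d_cont t] by (intro mult_mono) (auto simp: d_def)
      finally show "norm (U \<epsilon> \<gamma> t - V \<gamma> t) \<le> exp (\<rho> * T) * d \<gamma>" .
    qed (use T in simp)
    have d_rec: "d \<gamma> \<le> M' / \<rho> * (\<Sum>(\<alpha>, \<beta>)\<in>{(\<alpha>, \<beta>). \<alpha> + \<beta> = \<gamma>}. K * d \<beta> + W \<epsilon> \<alpha> \<beta>)" for \<gamma>
      unfolding d_def W_def
    proof (rule weighted_coefficient_difference[where R = "R \<epsilon>" and S = S and F = F and G = G])
      show "AE x in lborel. norm (R \<epsilon> \<alpha> x) \<le> K" for \<alpha> using R_le[OF \<epsilon>] by simp
    qed (use T \<rho> M' K S_le R[OF \<epsilon>] Q U_cont[OF \<epsilon>] V_cont U_weak[OF \<epsilon>] V_weak in auto)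
    fix A :: "multiindex set" assume A: "finite A"
    have sm: "(\<lambda>(\<alpha>, \<beta>). \<theta> \<alpha> * \<theta> \<beta> * W \<epsilon> \<alpha> \<beta>) summable_on UNIV"
      by (rule summable_on_comparison_test[OF g]) (use dominated[OF \<epsilon>] W0[OF \<epsilon>] \<theta>0 in auto)
    have "(\<Sum>\<gamma>\<in>A. \<theta> \<gamma> * sup_norm T (\<lambda>t. U \<epsilon> \<gamma> t - V \<gamma> t)) \<le> (\<Sum>\<gamma>\<in>A. \<theta> \<gamma> * (exp (\<rho> * T) * d \<gamma>))"
      using \<theta>0 U_le_d by (intro sum_mono mult_left_mono) auto
    also have "\<dots> = exp (\<rho> * T) * (\<Sum>\<gamma>\<in>A. \<theta> \<gamma> * d \<gamma>)"
      by (simp add: sum_distrib_left mult_ac)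
    also have "(\<Sum>\<gamma>\<in>A. \<theta> \<gamma> * d \<gamma>) \<le> 2 * (M' / \<rho>) * I \<epsilon>"
      unfolding I_def
    proof (rule weighted_convolution_absorption[OF \<theta>0 _ _ d0 d_rec W0[OF \<epsilon>] sm _ _ absorb A])
      show "\<theta> (\<alpha> + \<beta>) = \<theta> \<alpha> * \<theta> \<beta>" for \<alpha> \<beta> by (simp add: \<theta>_def two_N_pow_add_index)
      show "(\<Sum>\<alpha>\<in>A. \<theta> \<alpha>) \<le> 2" if "finite A" for A
        unfolding \<theta>_def by (rule sum_two_N_pow_le[OF \<theta>_exp that])
    qed (use M' \<rho> K in auto)
    finally show "(\<Sum>\<gamma>\<in>A. two_N_pow (- real p / 2) \<gamma> * sup_norm T (\<lambda>t. U \<epsilon> \<gamma> t - V \<gamma> t))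
        \<le> exp (\<rho> * T) * (2 * (M' / \<rho>) * I \<epsilon>)"
      by (simp add: \<theta>_def)
  qed
  have "((\<lambda>\<epsilon>. kondratiev_norm (sup_norm T) p (\<lambda>\<gamma> t. U \<epsilon> \<gamma> t - V \<gamma> t)) \<longlongrightarrow> 0) (at_right 0)"
  proof (rule tendsto_sandwich[OF _ _ tendsto_const])
    have "((\<lambda>\<epsilon>. exp (\<rho> * T) * (2 * (M' / \<rho>) * I \<epsilon>)) \<longlongrightarrow> 0) (at_right 0)"
      by (intro tendsto_mult_right_zero I)
    then show "((\<lambda>\<epsilon>. ennreal (exp (\<rho> * T) * (2 * (M' / \<rho>) * I \<epsilon>))) \<longlongrightarrow> 0) (at_right 0)"
      using tendsto_ennrealI by fastforce
    show "\<forall>\<^sub>F \<epsilon> in at_right 0. kondratiev_norm (sup_norm T) p (\<lambda>\<gamma> t. U \<epsilon> \<gamma> t - V \<gamma> t)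
        \<le> ennreal (exp (\<rho> * T) * (2 * (M' / \<rho>) * I \<epsilon>))"
      using unit by eventually_elim (rule bound)
  qed simp
  moreover have "p > 1" by (simp add: p_def)
  ultimately show ?thesis by blast
qed

end
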